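(* Let $A\in\mathbb{R}^{n\times n}$ and $c\in\mathbb{R}^n$, and consider the linear system $$\dot x=Ax,\quad y=c'x,\qquad x\in\mathbb{R}^n,\ y\in\mathbb{R}. \tag{Lin}$$ Suppose that there is a vector $k\in\mathbb{R}^n$ such that $A+kc'$ is Hurwitz. Let $P\in\mathbb{R}^{n\times n}$ be a symmetric positive definite matrix such that $P(A+kc')+(A'+ck')P$ is negative definite, and let $\mu,\gamma>0$ be constants such that $$x'P(A+kc')x+x'(A'+ck')Px+2x'Pkv\le-2\mu\,x'Px+\gamma|v|^2,\qquad\forall (x,v)\in\mathbb{R}^n\times\mathbb{R}.$$ Let $K_1,K_2>0$ be constants such that $K_1|x|^2\le x'Px\le K_2|x|^2$ for all $x\in\mathbb{R}^n$. If the upper diameter $r>0$ of the sampling partition satisfies $$r\,|c'A|\,\sqrt{\frac{\gamma}{2\mu K_1}}<1,$$ then the system $$\begin{aligned} \dot z(t)&=Az(t)+k\,(c'z(t)-w(t)),\\ \dot w(t)&=c'Az(t),\qquad t\in[\tau_i,\tau_{i+1}),\\ w(\tau_{i+1})&=y(\tau_{i+1}),\\ \hat x&=z, \end{aligned}$$ with state $(z(t),w(t))\in\mathbb{R}^n\times\mathbb{R}$ ($z$ being continuous at the sampling times $\tau_i$), is a robust sampled-data observer for (Lin) with respect to measurement errors.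
   Context: Notation. $|\cdot|$ is the Euclidean norm of vectors and the induced norm of matrices; $'$ denotes transpose; $\mathbb{R}^+=[0,\infty)$. $K^+$ is the class of positive continuous functions on $\mathbb{R}^+$. $N$ is the class of non-decreasing continuous $\gamma:\mathbb{R}^+\to\mathbb{R}^+$ with $\gamma(0)=0$. $K$ is the class of continuous, increasing $\rho:\mathbb{R}^+\to\mathbb{R}^+$ with $\rho(0)=0$ and $\rho(s)>0$ for $s>0$; $K_\infty$ is the class of $\rho\in K$ with $\lim_{s\to\infty}\rho(s)=\infty$. $KL$ is the class of continuous $\sigma:\mathbb{R}^+\times\mathbb{R}^+\to\mathbb{R}^+$ such that $\sigma(\cdot,t)\in K$ for each $t\ge0$, and for each $s\ge 0$ the map $\sigma(s,\cdot)$ is non-increasing with $\lim_{t\to\infty}\sigma(s,t)=0$. $L^\infty_{loc}(\mathbb{R}^+;D)$ is the class of Lebesgue measurable and locally bounded maps $\mathbb{R}^+\to D$; $\sup$ always denotes the actual supremum, not the essential supremum. Robust sampled-data observer. Let $\dot x=f(x)$, $y=h(x)$ be a system with $x\in\mathbb{R}^n$, $y\in\mathbb{R}$, $f\in C^1$, $h\in C^2$, $f(0)=0$, $h(0)=0$. A sampled-data system with state $\zeta\in\mathbb{R}^m$ has the form $\dot\zeta(t)=g(\zeta(t),\zeta(\tau_i),y(\tau_i))$ for $t\in[\tau_i,\tau_{i+1})$, $\zeta(\tau_{i+1})=G\big(\lim_{t\to\tau_{i+1}^-}\zeta(t),y(\tau_{i+1})\big)$, $\hat x(t)=\Phi(\zeta(t))$,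 where $g\in C^1(\mathbb{R}^m\times\mathbb{R}^m\times\mathbb{R};\mathbb{R}^m)$, $G\in C^0(\mathbb{R}^m\times\mathbb{R};\mathbb{R}^m)$, $\Phi\in C^1(\mathbb{R}^m;\mathbb{R}^n)$, all vanishing at the origin. It is a robust sampled-data observer for $\dot x=f(x)$, $y=h(x)$ with respect to measurement errors, with upper diameter $r>0$ of the sampling partition, if: (i) there exist $\sigma\in KL$, $\tilde\gamma,p\in N$, $\tilde\mu\in K^+$, $a\in K_\infty$ such that for every $(x_0,\zeta_0,d,v)\in\mathbb{R}^n\times\mathbb{R}^m\times L^\infty_{loc}(\mathbb{R}^+;\mathbb{R}^+)\times L^\infty_{loc}(\mathbb{R}^+;\mathbb{R})$ the solution of the hybrid system $\dot x(t)=f(x(t))$; $\dot\zeta(t)=g(\zeta(t),\zeta(\tau_i),y(\tau_i)+v(\tau_i))$, $t\in[\tau_i,\tau_{i+1})$; $\zeta(\tau_{i+1})=G\big(\lim_{t\to\tau_{i+1}^-}\zeta(t),y(\tau_{i+1})+v(\tau_{i+1})\big)$; $\tau_0=0$, $\tau_{i+1}=\tau_i+r\exp(-d(\tau_i))$; $\hat x(t)=\Phi(\zeta(t))$, where $y=h(x)$, with $(x(0),\zeta(0))=(x_0,\zeta_0)$ satisfies, for all $t\ge0$, $|\hat x(t)-x(t)|\le\sigma(|x_0|+|\zeta_0|,t)+\sup_{0\le\tau\le t}\tilde\gamma(|v(\tau)|)$ and $|\zeta(t)|\le\tilde\mu(t)\big[a(|x_0|+|\zeta_0|)+\sup_{0\le\tau\le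 t}p(|v(\tau)|)\big]$; (ii) for every $x_0\in\mathbb{R}^n$ there exists $\zeta_0\in\mathbb{R}^m$ such that for all $d\in L^\infty_{loc}(\mathbb{R}^+;\mathbb{R}^+)$ the solution with $(x(0),\zeta(0))=(x_0,\zeta_0)$ and $v\equiv0$ satisfies $x(t)=\Phi(\zeta(t))$ for all $t\ge0$. For the observer in the claim, $\zeta=(z,w)$, $m=n+1$, $g$ is the right-hand side of the $(z,w)$ differential equations, $G((z,w),y)=(z,y)$ and $\Phi(z,w)=z$. *)

theory Defs
  imports "HOL-Analysis.Analysis"
begin

section \<open>Comparison functions and input classes\<close>

text \<open>
  Functions with domain \<open>[0,\<infinity>)\<close> are represented by functions on all of \<^typ>\<open>real\<close> whose
  values at negative arguments are irrelevant.  Nonnegativity of the values follows from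
  monotonicity and the value \<open>0\<close> at \<open>0\<close>.
\<close>

definition class_Kplus :: "(real \<Rightarrow> real) set" where
  "class_Kplus = {m. continuous_on {0..} m \<and> (\<forall>t\<ge>0. 0 < m t)}"

definition class_N :: "(real \<Rightarrow> real) set" where
  "class_N = {\<gamma>. continuous_on {0..} \<gamma> \<and> mono_on {0..} \<gamma> \<and> \<gamma> 0 = 0}"

definition class_K :: "(real \<Rightarrow> real) set" where
  "class_K = {\<rho>. continuous_on {0..} \<rho> \<and> strict_mono_on {0..} \<rho> \<and> \<rho> 0 = 0}"

definition class_Kinf :: "(real \<Rightarrow> real) set" where
  "class_Kinf = {\<rho> \<in> class_K. filterlim \<rho> at_top at_top}"

definition class_KL :: "(real \<Rightarrow> real \<Rightarrow> real) set" where
  "class_KL = {\<sigma>. continuous_on ({0..} \<times> {0..}) (\<lambda>(s, t). \<sigma> s t)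
      \<and> (\<forall>t\<ge>0. (\<lambda>s. \<sigma> s t) \<in> class_K)
      \<and> (\<forall>s\<ge>0. antimono_on {0..} (\<sigma> s) \<and> (\<sigma> s \<longlongrightarrow> 0) at_top)}"

definition Linf_loc :: "'a::euclidean_space set \<Rightarrow> (real \<Rightarrow> 'a) set" where
  "Linf_loc D = {u. u \<in> borel_measurable (lebesgue_on {0..}) \<and> (\<forall>t\<ge>0. u t \<in> D)
      \<and> (\<forall>T\<ge>0. bounded (u ` {0..T}))}"


section \<open>Smoothness\<close>

definition C1_map :: "('a::real_normed_vector \<Rightarrow> 'b::real_normed_vector) \<Rightarrow> bool" where
  "C1_map f \<longleftrightarrow> (\<exists>f' :: 'a \<Rightarrow> 'a \<Rightarrow>\<^sub>L 'b.
      (\<forall>x. (f has_derivative blinfun_apply (f' x)) (at x)) \<and> continuous_on UNIV f')"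

definition C2_map :: "('a::real_normed_vector \<Rightarrow> 'b::real_normed_vector) \<Rightarrow> bool" where
  "C2_map f \<longleftrightarrow> (\<exists>f' :: 'a \<Rightarrow> 'a \<Rightarrow>\<^sub>L 'b.
      (\<forall>x. (f has_derivative blinfun_apply (f' x)) (at x)) \<and> C1_map f')"


section \<open>Sampled-data observers\<close>

definition admissible_system ::
    "('n::euclidean_space \<Rightarrow> 'n) \<Rightarrow> ('n \<Rightarrow> real) \<Rightarrow> bool" where
  "admissible_system f h \<longleftrightarrow> C1_map f \<and> C2_map h \<and> f 0 = 0 \<and> h 0 = 0"

definition admissible_sampled_data_system ::
    "('m::euclidean_space \<times> 'm \<times> real \<Rightarrow> 'm) \<Rightarrow> ('m \<times> real \<Rightarrow> 'm) \<Rightarrow>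
     ('m \<Rightarrow> 'n::euclidean_space) \<Rightarrow> bool" where
  "admissible_sampled_data_system g G \<Phi> \<longleftrightarrow>
     C1_map g \<and> continuous_on UNIV G \<and> C1_map \<Phi> \<and> g 0 = 0 \<and> G 0 = 0 \<and> \<Phi> 0 = 0"

primrec sampling_time :: "real \<Rightarrow> (real \<Rightarrow> real) \<Rightarrow> nat \<Rightarrow> real" where
  "sampling_time r d 0 = 0"
| "sampling_time r d (Suc i) = sampling_time r d i + r * exp (- d (sampling_time r d i))"

text \<open>
  Solutions on \<open>[0,\<infinity>)\<close> of the hybrid system.  Since \<open>\<zeta>(\<tau>\<^sub>i)\<close> and the sampled output are frozen
  on \<open>[\<tau>\<^sub>i,\<tau>\<^sub>i\<^sub>+\<^sub>1)\<close> and \<open>g\<close> is continuous, solutions are classical; the derivative at the left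
  end point is one-sided, so \<open>\<zeta>\<close> is right-continuous at the sampling times.
\<close>

definition hybrid_solution ::
    "('n::euclidean_space \<Rightarrow> 'n) \<Rightarrow> ('n \<Rightarrow> real) \<Rightarrow>
     ('m::euclidean_space \<times> 'm \<times> real \<Rightarrow> 'm) \<Rightarrow> ('m \<times> real \<Rightarrow> 'm) \<Rightarrow> real \<Rightarrow>
     'n \<Rightarrow> 'm \<Rightarrow> (real \<Rightarrow> real) \<Rightarrow> (real \<Rightarrow> real) \<Rightarrow> (real \<Rightarrow> 'n) \<Rightarrow> (real \<Rightarrow> 'm) \<Rightarrow> bool" where
  "hybrid_solution f h g G r x0 \<zeta>0 d v x \<zeta> \<longleftrightarrow>
     (let \<tau> = sampling_time r d in
       x 0 = x0 \<and> \<zeta> 0 = \<zeta>0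
     \<and> (\<forall>t\<ge>0. (x has_vector_derivative f (x t)) (at t within {0..}))
     \<and> (\<forall>i. \<forall>t\<in>{\<tau> i..<\<tau> (Suc i)}.
          (\<zeta> has_vector_derivative g (\<zeta> t, \<zeta> (\<tau> i), h (x (\<tau> i)) + v (\<tau> i)))
            (at t within {\<tau> i..<\<tau> (Suc i)}))
     \<and> (\<forall>i. \<exists>l. (\<zeta> \<longlongrightarrow> l) (at_left (\<tau> (Suc i)))
          \<and> \<zeta> (\<tau> (Suc i)) = G (l, h (x (\<tau> (Suc i))) + v (\<tau> (Suc i)))))"

text \<open>
  ``The solution satisfies \<open>Q\<close> for all \<open>t \<ge> 0\<close>'' includes that the solution exists on \<open>[0,\<infinity>)\<close>.
  For \<open>f\<close>, \<open>g\<close> of class \<open>C\<^sup>1\<close> it is unique on \<open>[0,\<infinity>)\<close>; uniqueness is not stated as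
  values at negative times are arbitrary, and \<open>Q\<close> is required of every solution instead.
\<close>

definition the_solution_satisfies ::
    "('n::euclidean_space \<Rightarrow> 'n) \<Rightarrow> ('n \<Rightarrow> real) \<Rightarrow>
     ('m::euclidean_space \<times> 'm \<times> real \<Rightarrow> 'm) \<Rightarrow> ('m \<times> real \<Rightarrow> 'm) \<Rightarrow> real \<Rightarrow>
     'n \<Rightarrow> 'm \<Rightarrow> (real \<Rightarrow> real) \<Rightarrow> (real \<Rightarrow> real) \<Rightarrow>
     ((real \<Rightarrow> 'n) \<Rightarrow> (real \<Rightarrow> 'm) \<Rightarrow> real \<Rightarrow> bool) \<Rightarrow> bool" where
  "the_solution_satisfies f h g G r x0 \<zeta>0 d v Q \<longleftrightarrow>
     (\<exists>x \<zeta>. hybrid_solution f h g G r x0 \<zeta>0 d v x \<zeta>)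
   \<and> (\<forall>x \<zeta>. hybrid_solution f h g G r x0 \<zeta>0 d v x \<zeta> \<longrightarrow> (\<forall>t\<ge>0. Q x \<zeta> t))"

definition robust_sampled_data_observer ::
    "('n::euclidean_space \<Rightarrow> 'n) \<Rightarrow> ('n \<Rightarrow> real) \<Rightarrow>
     ('m::euclidean_space \<times> 'm \<times> real \<Rightarrow> 'm) \<Rightarrow> ('m \<times> real \<Rightarrow> 'm) \<Rightarrow> ('m \<Rightarrow> 'n) \<Rightarrow>
     real \<Rightarrow> bool" where
  "robust_sampled_data_observer f h g G \<Phi> r \<longleftrightarrow>
     admissible_system f h \<and> admissible_sampled_data_system g G \<Phi> \<and> 0 < r
   \<and> (\<exists>\<sigma>\<in>class_KL. \<exists>\<gamma>\<in>class_N. \<exists>p\<in>class_N. \<exists>m\<in>class_Kplus. \<exists>a\<in>class_Kinf.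
        \<forall>x0 \<zeta>0. \<forall>d\<in>Linf_loc {0..}. \<forall>v\<in>Linf_loc UNIV.
          the_solution_satisfies f h g G r x0 \<zeta>0 d v (\<lambda>x \<zeta> t.
            norm (\<Phi> (\<zeta> t) - x t)
              \<le> \<sigma> (norm x0 + norm \<zeta>0) t + (SUP s\<in>{0..t}. \<gamma> \<bar>v s\<bar>)
          \<and> norm (\<zeta> t) \<le> m t * (a (norm x0 + norm \<zeta>0) + (SUP s\<in>{0..t}. p \<bar>v s\<bar>))))
   \<and> (\<forall>x0. \<exists>\<zeta>0. \<forall>d\<in>Linf_loc {0..}.
        the_solution_satisfies f h g G r x0 \<zeta>0 d (\<lambda>_. 0) (\<lambda>x \<zeta> t. x t = \<Phi> (\<zeta> t)))"


section \<open>Matrices\<close>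

definition outer_product :: "real^'m \<Rightarrow> real^'n \<Rightarrow> real^'n^'m" where
  "outer_product u v = (\<chi> i j. u $ i * v $ j)"

definition hurwitz :: "real^'n^'n \<Rightarrow> bool" where
  "hurwitz M \<longleftrightarrow> (\<forall>(s::complex) (x::complex^'n).
      x \<noteq> 0 \<and> (\<chi> i j. complex_of_real (M $ i $ j)) *v x = s *s x \<longrightarrow> Re s < 0)"

definition positive_definite :: "real^'n^'n \<Rightarrow> bool" where
  "positive_definite M \<longleftrightarrow> (\<forall>x. x \<noteq> 0 \<longrightarrow> 0 < x \<bullet> (M *v x))"

definition negative_definite :: "real^'n^'n \<Rightarrow> bool" where
  "negative_definite M \<longleftrightarrow> (\<forall>x. x \<noteq> 0 \<longrightarrow> x \<bullet> (M *v x) < 0)"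


section \<open>The observer for the linear system\<close>

text \<open>The state is \<open>(z, w)\<close>; \<open>(z\<^sub>0, w\<^sub>0)\<close> and \<open>y\<^sub>0\<close> are the values at the last sampling time.\<close>

definition lin_observer_flow ::
    "real^'n^'n \<Rightarrow> real^'n \<Rightarrow> real^'n \<Rightarrow>
     ((real^'n) \<times> real) \<times> ((real^'n) \<times> real) \<times> real \<Rightarrow> (real^'n) \<times> real" where
  "lin_observer_flow A c k = (\<lambda>((z, w), (z0, w0), y0).
      (A *v z + (c \<bullet> z - w) *\<^sub>R k, c \<bullet> (A *v z)))"

definition lin_observer_jump :: "((real^'n) \<times> real) \<times> real \<Rightarrow> (real^'n) \<times> real" where
  "lin_observer_jump = (\<lambda>((z, w), y). (z, y))"

end

theory Submission
  imports Defs
begin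

text \<open>
  The error \<open>e = z - x\<close> and the prediction error \<open>\<eta> = c'x - w\<close> satisfy
  \<open>e' = (A + kc')e + k\<eta>\<close> and \<open>\<eta>' = -c'Ae\<close> between samples, and \<open>\<eta>(\<tau>\<^sub>i) = -v(\<tau>\<^sub>i)\<close> for \<open>i \<ge> 1\<close>.
  Hence \<open>V = e'Pe\<close> obeys \<open>V' \<le> -2\<mu>V + \<gamma>\<eta>\<^sup>2\<close>, while
  \<open>|\<eta>(t)| \<le> |\<eta>(\<tau>\<^sub>i)| + r |c'A| sup |e|\<close>.  Weighting both inequalities with \<open>exp(\<omega>t)\<close>, the loop gain
  is \<open>r |c'A| exp(\<omega>r) sqrt(\<gamma> / (2(\<mu> - \<omega>)K\<^sub>1))\<close>, which for small \<open>\<omega> > 0\<close> is still below \<open>1\<close>.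
  So the maximum of \<open>exp(\<omega>t)|e(t)|\<close> on \<open>[0,T]\<close> is bounded linearly by the initial data and
  \<open>exp(\<omega>T) sup |v|\<close>; evaluating at \<open>T\<close> gives exponential decay with a linear noise gain.
  For the exact initialisation \<open>(z, w) = (x\<^sub>0, c'x\<^sub>0)\<close> the bound is zero.
\<close>

section \<open>Linear differential equations\<close>

text \<open>The solution is the exponential series with terms
  \<open>(t ^ n / fact n) *\<^sub>R (F ^^ n) x0\<close>. Differentiation is reduced to real power
  series by taking inner products with a vector b.\<close>

lemma linear_ode_solution:
  fixes F :: "'a::euclidean_space \<Rightarrow> 'a"
  assumes "bounded_linear F"
  obtains \<psi> where "\<psi> 0 = x0" "\<And>t. (\<psi> has_vector_derivative F (\<psi> t)) (at t)"
proof -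
  interpret F: bounded_linear F by fact
  define u where "u t n = (t ^ n / fact n) *\<^sub>R (F ^^ n) x0" for t :: real and n
  have pow: "norm ((F ^^ n) x0) \<le> onorm F ^ n * norm x0" for n
  proof (induction n)
    case (Suc n)
    have "norm (F ((F ^^ n) x0)) \<le> onorm F * norm ((F ^^ n) x0)"
      by (rule onorm[OF assms])
    also have "\<dots> \<le> onorm F * (onorm F ^ n * norm x0)"
      by (intro mult_left_mono Suc onorm_pos_le[OF assms])
    finally show ?case by simp
  qed simp
  have summ: "summable (u t)" for t
  proof (rule summable_comparison_test)
    show "summable (\<lambda>n. inverse (fact n) * (\<bar>t\<bar> * onorm F) ^ n * norm x0)"
      by (intro summable_mult2 summable_exp)
    have "norm (u t n) \<le> inverse (fact n) * (\<bar>t\<bar> * onorm F) ^ n * norm x0" for n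
    proof -
      have "norm (u t n) = inverse (fact n) * \<bar>t\<bar> ^ n * norm ((F ^^ n) x0)"
        by (simp add: u_def power_abs field_simps)
      also have "\<dots> \<le> inverse (fact n) * \<bar>t\<bar> ^ n * (onorm F ^ n * norm x0)"
        by (intro mult_left_mono pow) auto
      finally show ?thesis by (simp add: power_mult_distrib mult_ac)
    qed
    then show "\<exists>N. \<forall>n\<ge>N. norm (u t n) \<le> inverse (fact n) * (\<bar>t\<bar> * onorm F) ^ n * norm x0"
      by blast
  qed
  define \<psi> where "\<psi> t = suminf (u t)" for t
  have \<psi>: "u t sums \<psi> t" for t
    unfolding \<psi>_def by (rule summable_sums[OF summ])
  define a where "a b n = ((F ^^ n) x0 \<bullet> b) / fact n" for b n
  have ser: "(\<lambda>n. a b n * t ^ n) sums (\<psi> t \<bullet> b)" for b t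
    using bounded_linear.sums[OF bounded_linear_inner_left \<psi>, of t b]
    by (simp add: u_def a_def mult_ac)
  \<comment> \<open>Termwise differentiation shifts the index and cancels one factor of the
    factorial, which is exactly one further application of F.\<close>
  have ser': "(\<lambda>n. diffs (a b) n * t ^ n) sums (F (\<psi> t) \<bullet> b)" for b t
  proof -
    have "(\<lambda>n. F (u t n) \<bullet> b) sums (F (\<psi> t) \<bullet> b)"
      by (intro bounded_linear.sums[OF bounded_linear_inner_left] F.sums \<psi>)
    moreover have "F (u t n) \<bullet> b = diffs (a b) n * t ^ n" for n
      by (simp add: u_def a_def diffs_def F.scaleR divide_simps)
    ultimately show ?thesis by simp
  qed
  have comp: "((\<lambda>t. \<psi> t \<bullet> b) has_field_derivative F (\<psi> t) \<bullet> b) (at t)" for b t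
  proof -
    have "((\<lambda>t. \<Sum>n. a b n * t ^ n) has_field_derivative (\<Sum>n. diffs (a b) n * t ^ n)) (at t)"
      by (rule termdiffs_strong_converges_everywhere) (use ser sums_summable in blast)
    then show ?thesis
      using sums_unique[OF ser] sums_unique[OF ser'] by simp
  qed
  have "\<psi> 0 = x0"
  proof (rule euclidean_eqI)
    fix b :: 'a
    have "(\<lambda>n. a b n * 0 ^ n) sums a b 0" by (rule powser_sums_zero)
    then show "\<psi> 0 \<bullet> b = x0 \<bullet> b"
      using sums_unique2[OF ser] by (simp add: a_def)
  qed
  moreover have "(\<psi> has_vector_derivative F (\<psi> t)) (at t)" for t
    unfolding has_vector_derivative_def has_derivative_componentwise_within[of \<psi>]
    using comp by (auto simp: has_field_derivative_def mult_commute_abs)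
  ultimately show ?thesis using that by blast
qed

text \<open>Gronwall argument: \<open>exp (- 2 * onorm F * s)\<close> times the squared norm is
  nonincreasing. The square is used because the norm itself may fail to be differentiable at
  0.\<close>

lemma exponential_growth_bound:
  fixes x :: "real \<Rightarrow> 'a::euclidean_space"
  assumes F: "bounded_linear F"
    and x: "\<And>t. t \<ge> 0 \<Longrightarrow> (x has_vector_derivative F (x t)) (at t within {0..})"
    and "t \<ge> 0"
  shows "norm (x t) \<le> exp (onorm F * t) * norm (x 0)"
proof -
  define U where "U s = exp (- 2 * onorm F * s) * (x s \<bullet> x s)" for s
  have "continuous_on {0..} x"
    using x has_vector_derivative_continuous
    by (fastforce simp: continuous_on_eq_continuous_within)
  then have contU: "continuous_on {0..t} U"
    unfolding U_def by (intro continuous_intros) (auto intro: continuous_on_subset)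
  have "U t \<le> U 0"
  proof (rule DERIV_nonpos_imp_decreasing_open[OF assms(3) _ contU])
    fix s assume s: "0 < s" "s < t"
    have "at s within {0..} = at s"
      by (rule at_within_interior) (use s in simp)
    then have h: "(x has_vector_derivative F (x s)) (at s)"
      using x[of s] s by simp
    have xx: "((\<lambda>s. x s \<bullet> x s) has_real_derivative 2 * (x s \<bullet> F (x s))) (at s)"
      unfolding has_real_derivative_iff_has_vector_derivative
      using bounded_bilinear.has_vector_derivative[OF bounded_bilinear_inner h h]
      by (simp add: inner_commute)
    have "(U has_real_derivative
        exp (- 2 * onorm F * s) * (2 * (x s \<bullet> F (x s)) - 2 * onorm F * (x s \<bullet> x s))) (at s)"
      unfolding U_def by (auto intro!: derivative_eq_intros xx simp: algebra_simps)
    moreover have "x s \<bullet> F (x s) \<le> onorm F * (x s \<bullet> x s)"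
    proof -
      have "x s \<bullet> F (x s) \<le> norm (x s) * norm (F (x s))" by (rule norm_cauchy_schwarz)
      also have "\<dots> \<le> norm (x s) * (onorm F * norm (x s))"
        by (intro mult_left_mono onorm[OF F]) auto
      finally show ?thesis by (simp add: dot_square_norm power2_eq_square mult_ac)
    qed
    ultimately show "\<exists>y. (U has_real_derivative y) (at s) \<and> y \<le> 0"
      by - (rule exI, rule conjI, assumption, simp add: mult_nonneg_nonpos)
  qed
  then have "exp (- 2 * onorm F * t) * (norm (x t))\<^sup>2 \<le> (norm (x 0))\<^sup>2"
    by (simp add: U_def dot_square_norm)
  moreover have "exp (- 2 * onorm F * t) = (exp (- onorm F * t))\<^sup>2"
    by (simp add: power2_eq_square flip: exp_add)
  ultimately have "(exp (- onorm F * t) * norm (x t))\<^sup>2 \<le> (norm (x 0))\<^sup>2"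
    by (simp add: power_mult_distrib)
  then have "exp (- onorm F * t) * norm (x t) \<le> norm (x 0)"
    by (rule power2_le_imp_le) simp
  then show ?thesis by (simp add: exp_minus field_simps)
qed

section \<open>The small-gain estimate\<close>

text \<open>The mean value theorem needs the derivative only at interior points. This suits sampling
  intervals, at whose left end only a one-sided derivative is available.\<close>

lemma bound_after_sample:
  fixes \<eta> :: "real \<Rightarrow> real"
  assumes "s \<le> t" "continuous_on {s..t} \<eta>" "0 \<le> L" "0 \<le> E"
    and "\<And>u. s < u \<Longrightarrow> u < t \<Longrightarrow> \<exists>D. (\<eta> has_real_derivative D) (at u) \<and> \<bar>D\<bar> \<le> L * norm (e u)"
    and "\<And>u. s < u \<Longrightarrow> u < t \<Longrightarrow> norm (e u) \<le> E"
  shows "\<bar>\<eta> t\<bar> \<le> \<bar>\<eta> s\<bar> + (t - s) * (L * E)"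
proof (cases "s = t")
  case False
  with assms(1) have "s < t" by simp
  then obtain l u where u: "s < u" "u < t" "(\<eta> has_real_derivative l) (at u)"
      "\<eta> t - \<eta> s = (t - s) * l"
    using MVT[of s t \<eta>] assms(2,5) by (metis real_differentiable_def)
  have "\<bar>l\<bar> \<le> L * norm (e u)" using assms(5)[OF u(1,2)] u(3) DERIV_unique by blast
  also have "\<dots> \<le> L * E" by (intro mult_left_mono assms u)
  finally have "(t - s) * \<bar>l\<bar> \<le> (t - s) * (L * E)"
    using assms(1) by (intro mult_left_mono) auto
  moreover have "\<bar>\<eta> t\<bar> \<le> \<bar>\<eta> s\<bar> + (t - s) * \<bar>l\<bar>"
    using u(4) \<open>s < t\<close> by (metis abs_mult abs_of_pos abs_triangle_ineq diff_gt_0_iff_gt add.commute diff_add_cancel)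
  ultimately show ?thesis by linarith
qed simp

lemma sampling_index:
  fixes \<tau> :: "nat \<Rightarrow> real"
  assumes "\<tau> 0 \<le> t" "t < \<tau> N"
  obtains i where "i < N" "\<tau> i \<le> t" "t < \<tau> (Suc i)"
  using assms
proof (induction N arbitrary: thesis)
  case (Suc N)
  show ?case
  proof (cases "t < \<tau> N")
    case True
    with Suc show ?thesis by (metis less_Suc_eq)
  next
    case False
    with Suc show ?thesis by (metis lessI not_less)
  qed
qed simp

text \<open>The jumps of \<eta> make the derivative of V discontinuous at sampling times.
  Monotonicity is therefore obtained interval by interval and chained through the nodes, using
  continuity of U there.\<close>

lemma piecewise_nonincreasing:
  fixes U :: "real \<Rightarrow> real"
  assumes mono: "\<And>i. \<tau> i < \<tau> (Suc i)"
    and "continuous_on {\<tau> 0..T} U"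
    and deriv: "\<And>i t. \<tau> i < t \<Longrightarrow> t < \<tau> (Suc i) \<Longrightarrow> t < T
          \<Longrightarrow> \<exists>D. (U has_real_derivative D) (at t) \<and> D \<le> 0"
    and "\<tau> 0 \<le> t" "t \<le> T" "t < \<tau> N"
  shows "U t \<le> U (\<tau> 0)"
proof -
  have sm: "strict_mono \<tau>" using mono by (simp add: strict_mono_Suc_iff)
  have step: "U t \<le> U (\<tau> i)" if "\<tau> i \<le> t" "t \<le> \<tau> (Suc i)" "t \<le> T" for i t
  proof (rule DERIV_nonpos_imp_decreasing_open[OF that(1)])
    have "\<tau> 0 \<le> \<tau> i" using sm by (simp add: strict_mono_less_eq)
    then show "continuous_on {\<tau> i..t} U"
      by (intro continuous_on_subset[OF assms(2)]) (use that in auto)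
  qed (use deriv that in fastforce)
  have nodes: "\<tau> i \<le> T \<Longrightarrow> U (\<tau> i) \<le> U (\<tau> 0)" for i
  proof (induction i)
    case (Suc i)
    then show ?case
      using step[of i "\<tau> (Suc i)"] mono[of i] by force
  qed simp
  obtain i where "\<tau> i \<le> t" "t < \<tau> (Suc i)"
    using sampling_index[OF assms(4,6)] .
  then show ?thesis
    using step[of i t] nodes[of i] assms(5) by simp
qed


text \<open>\<open>q0\<close> carries the initial prediction error, which is allowed to decay, and
  \<open>W\<close> the noise, which is not. In the weighted norm the noise costs
  \<open>exp (\<omega> * T) * W\<close>, so the result is stated only at the right end T, where this
  factor cancels.\<close>

lemma weighted_small_gain:
  fixes e :: "real \<Rightarrow> 'a::real_normed_vector" and \<eta> V :: "real \<Rightarrow> real" and \<tau> :: "nat \<Rightarrow> real"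
  assumes \<tau>0: "\<tau> 0 = 0" and mono: "\<And>i. \<tau> i < \<tau> (Suc i)" and diam: "\<And>i. \<tau> (Suc i) - \<tau> i \<le> r"
    and T: "0 \<le> T" "T < \<tau> M"
    and pos: "0 < \<omega>" "\<omega> < \<mu>" "0 < \<gamma>" "0 < K1" "0 < K2" "0 \<le> L" "0 \<le> q0" "0 \<le> W"
    and cont: "continuous_on {0..T} e" "continuous_on {0..T} V"
      "\<And>i. continuous_on {\<tau> i..<\<tau> (Suc i)} \<eta>"
    and V': "\<And>i t. \<tau> i < t \<Longrightarrow> t < \<tau> (Suc i) \<Longrightarrow>
      \<exists>D. (V has_real_derivative D) (at t) \<and> D \<le> - 2 * \<mu> * V t + \<gamma> * (\<eta> t)\<^sup>2"
    and \<eta>': "\<And>i t. \<tau> i < t \<Longrightarrow> t < \<tau> (Suc i) \<Longrightarrow>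
      \<exists>D. (\<eta> has_real_derivative D) (at t) \<and> \<bar>D\<bar> \<le> L * norm (e t)"
    and V: "\<And>t. 0 \<le> t \<Longrightarrow> K1 * (norm (e t))\<^sup>2 \<le> V t" "V 0 \<le> K2 * (norm (e 0))\<^sup>2"
    and sample: "\<And>i. \<tau> i \<le> T \<Longrightarrow> \<bar>\<eta> (\<tau> i)\<bar> \<le> exp (- \<omega> * \<tau> i) * q0 + W"
  defines "\<Theta> \<equiv> sqrt (\<gamma> / (2 * (\<mu> - \<omega>) * K1))"
  assumes gain: "r * L * exp (\<omega> * r) * \<Theta> < 1"
  shows "(1 - r * L * exp (\<omega> * r) * \<Theta>) * norm (e T)
    \<le> exp (- \<omega> * T) * (sqrt (K2 / K1) * norm (e 0) + exp (\<omega> * r) * \<Theta> * q0) + exp (\<omega> * r) * \<Theta> * W"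
proof -
  have r: "0 \<le> r" using mono[of 0] diam[of 0] by simp
  have sm: "strict_mono \<tau>" using mono by (simp add: strict_mono_Suc_iff)
  then have \<tau>pos: "0 \<le> \<tau> i" for i using \<tau>0 by (metis strict_mono_less_eq zero_le)
  have \<Theta>: "0 \<le> \<Theta>" unfolding \<Theta>_def using pos by simp
  \<comment> \<open>Compactness of [0,T] makes the weighted maximum finite and attained, which later
    permits moving q E to the left side of the inequality.\<close>
  have "\<exists>sm\<in>{0..T}. \<forall>s\<in>{0..T}. exp (\<omega> * s) * norm (e s) \<le> exp (\<omega> * sm) * norm (e sm)"
    by (intro continuous_attains_sup continuous_intros cont) (use T in auto)
  then obtain sm where sm: "0 \<le> sm" "sm \<le> T"
    and sm_max: "\<And>s. 0 \<le> s \<Longrightarrow> s \<le> T \<Longrightarrow> exp (\<omega> * s) * norm (e s) \<le> exp (\<omega> * sm) * norm (e sm)"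
    by auto
  define E where "E = exp (\<omega> * sm) * norm (e sm)"
  have E: "0 \<le> E" by (simp add: E_def)
  have eE: "norm (e s) \<le> exp (- \<omega> * s) * E" if "0 \<le> s" "s \<le> T" for s
    using sm_max[OF that] by (simp add: E_def exp_minus field_simps)
  \<comment> \<open>N bounds \<open>exp (\<omega> * t) * \<bar>\<eta> t\<bar>\<close> on [0,T]: the
    value at the last sample plus the growth since then. The factor
    \<open>exp (\<omega> * r)\<close> pays for comparing the weights at t and at that sample, which
    are at most r apart.\<close>
  define N where "N = exp (\<omega> * r) * (q0 + exp (\<omega> * T) * W + r * L * E)"
  have N: "0 \<le> N" unfolding N_def using pos r E by simp
  have \<eta>N: "(\<eta> t)\<^sup>2 \<le> N\<^sup>2 * exp (- 2 * \<omega> * t)" if t: "\<tau> i \<le> t" "t < \<tau> (Suc i)" "t \<le> T" for i t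
  proof -
    have "\<bar>\<eta> t\<bar> \<le> \<bar>\<eta> (\<tau> i)\<bar> + (t - \<tau> i) * (L * (exp (- \<omega> * \<tau> i) * E))"
    proof (rule bound_after_sample[where e = e])
      show "continuous_on {\<tau> i..t} \<eta>"
        by (rule continuous_on_subset[OF cont(3)[of i]]) (use t in auto)
      fix u assume u: "\<tau> i < u" "u < t"
      show "\<exists>D. (\<eta> has_real_derivative D) (at u) \<and> \<bar>D\<bar> \<le> L * norm (e u)"
        by (rule \<eta>'[of i]) (use u t in auto)
      have "norm (e u) \<le> exp (- \<omega> * u) * E"
        using u t \<tau>pos[of i] by (intro eE) auto
      also have "\<dots> \<le> exp (- \<omega> * \<tau> i) * E"
        using u pos E by (intro mult_right_mono) auto
      finally show "norm (e u) \<le> exp (- \<omega> * \<tau> i) * E" .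
    qed (use t E in \<open>auto simp: pos\<close>)
    also have "\<dots> \<le> (exp (- \<omega> * \<tau> i) * q0 + W) + r * (L * (exp (- \<omega> * \<tau> i) * E))"
      using sample[of i] t diam[of i] pos E by (intro add_mono mult_right_mono) auto
    also have "\<dots> = exp (- \<omega> * \<tau> i) * (q0 + exp (\<omega> * \<tau> i) * W + r * L * E)"
      by (simp add: exp_minus field_simps)
    also have "\<dots> \<le> exp (- \<omega> * t) * exp (\<omega> * r) * (q0 + exp (\<omega> * T) * W + r * L * E)"
    proof (rule mult_mono)
      have "t - \<tau> i \<le> r" using t diam[of i] by simp
      then have "\<omega> * (t - \<tau> i) \<le> \<omega> * r" using pos by (intro mult_left_mono) auto
      then show "exp (- \<omega> * \<tau> i) \<le> exp (- \<omega> * t) * exp (\<omega> * r)"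
        by (simp add: algebra_simps flip: exp_add)
      show "q0 + exp (\<omega> * \<tau> i) * W + r * L * E \<le> q0 + exp (\<omega> * T) * W + r * L * E"
        using t pos r E by (intro add_mono mult_right_mono) auto
    qed (use pos r E \<tau>pos in auto)
    finally have "\<bar>\<eta> t\<bar> \<le> exp (- \<omega> * t) * N" by (simp add: N_def mult_ac)
    then have "\<bar>\<eta> t\<bar>\<^sup>2 \<le> (exp (- \<omega> * t) * N)\<^sup>2" by (rule power_mono) simp
    then show ?thesis by (simp add: power_mult_distrib mult_ac flip: exp_double)
  qed
  \<comment> \<open>\<open>B * exp (- 2 * \<omega> * t)\<close> solves the comparison equation V' =
    -2 \<mu> V + \<gamma> \<open>N\<^sup>2 * exp (- 2 * \<omega> * t)\<close>. U is the deviation of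
    V from this solution, multiplied by the integrating factor.\<close>
  define B where "B = \<gamma> * N\<^sup>2 / (2 * (\<mu> - \<omega>))"
  have B: "0 \<le> B" "2 * (\<mu> - \<omega>) * B = \<gamma> * N\<^sup>2" using pos by (auto simp: B_def)
  define U where "U t = exp (2 * \<mu> * t) * V t - B * exp (2 * (\<mu> - \<omega>) * t)" for t
  have U0: "U t \<le> U 0" if "0 \<le> t" "t \<le> T" for t
  proof -
    have "U t \<le> U (\<tau> 0)"
    proof (rule piecewise_nonincreasing[where U = U and \<tau> = \<tau> and T = T and N = M])
      show "continuous_on {\<tau> 0..T} U"
        unfolding U_def \<tau>0 by (intro continuous_intros cont)
      fix i t assume t: "\<tau> i < t" "t < \<tau> (Suc i)" "t < T"
      obtain D where D: "(V has_real_derivative D) (at t)" "D \<le> - 2 * \<mu> * V t + \<gamma> * (\<eta> t)\<^sup>2"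
        using V'[OF t(1,2)] by blast
      have "(U has_real_derivative
          exp (2 * \<mu> * t) * (D + 2 * \<mu> * V t) - 2 * (\<mu> - \<omega>) * B * exp (2 * (\<mu> - \<omega>) * t)) (at t)"
        unfolding U_def by (auto intro!: derivative_eq_intros D(1) simp: algebra_simps)
      moreover have "exp (2 * \<mu> * t) * (D + 2 * \<mu> * V t) \<le> exp (2 * \<mu> * t) * (\<gamma> * (N\<^sup>2 * exp (- 2 * \<omega> * t)))"
      proof (rule mult_left_mono)
        have "\<gamma> * (\<eta> t)\<^sup>2 \<le> \<gamma> * (N\<^sup>2 * exp (- 2 * \<omega> * t))"
          using \<eta>N[of i t] t pos by (intro mult_left_mono) auto
        then show "D + 2 * \<mu> * V t \<le> \<gamma> * (N\<^sup>2 * exp (- 2 * \<omega> * t))" using D(2) by linarith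
      qed simp
      moreover have "exp (2 * \<mu> * t) * (\<gamma> * (N\<^sup>2 * exp (- 2 * \<omega> * t)))
          = 2 * (\<mu> - \<omega>) * B * exp (2 * (\<mu> - \<omega>) * t)"
      proof -
        have "exp (2 * (\<mu> - \<omega>) * t) = exp (2 * \<mu> * t) * exp (- 2 * \<omega> * t)"
          by (simp add: algebra_simps flip: exp_add)
        then show ?thesis unfolding B(2) by simp
      qed
      ultimately show "\<exists>D. (U has_real_derivative D) (at t) \<and> D \<le> 0"
        by - (rule exI, rule conjI, assumption, linarith)
    qed (use mono that T \<tau>0 in auto)
    then show ?thesis by (simp add: \<tau>0)
  qed
  have bound: "exp (\<omega> * t) * norm (e t) \<le> sqrt (K2 / K1) * norm (e 0) + \<Theta> * N"
    if t: "0 \<le> t" "t \<le> T" for t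
  proof -
    define R where "R = exp (2 * (\<mu> - \<omega>) * t)"
    have R: "1 \<le> R" using pos t by (simp add: R_def)
    \<comment> \<open>The integrating factor splits into the squared weight and a remainder R. Since
      R is at least 1 and V 0 is nonnegative, V 0 is absorbed into R V 0 and R can be
      cancelled.\<close>
    have ex: "exp (2 * \<mu> * t) = R * (exp (\<omega> * t))\<^sup>2"
      by (simp add: R_def algebra_simps flip: exp_add exp_double)
    have V0: "0 \<le> V 0" using V(1)[of 0] pos by (meson order_refl order_trans zero_le_mult_iff zero_le_power2 less_imp_le)
    have "R * ((exp (\<omega> * t))\<^sup>2 * V t) \<le> V 0 + B * R"
      using U0[OF t] B(1) unfolding U_def ex by (simp add: R_def algebra_simps)
    also have "\<dots> \<le> R * (V 0 + B)"
      using mult_right_mono[OF R V0] by (simp add: algebra_simps)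
    finally have "(exp (\<omega> * t))\<^sup>2 * V t \<le> V 0 + B" using R by simp
    moreover have "K1 * (exp (\<omega> * t) * norm (e t))\<^sup>2 \<le> (exp (\<omega> * t))\<^sup>2 * V t"
      using mult_left_mono[OF V(1)[OF t(1)], of "(exp (\<omega> * t))\<^sup>2"]
      by (simp add: power_mult_distrib mult_ac)
    ultimately have "K1 * (exp (\<omega> * t) * norm (e t))\<^sup>2 \<le> K2 * (norm (e 0))\<^sup>2 + B"
      using V(2) by linarith
    then have "(exp (\<omega> * t) * norm (e t))\<^sup>2 \<le> (K2 * (norm (e 0))\<^sup>2 + B) / K1"
      using pos by (simp add: pos_le_divide_eq mult.commute)
    \<comment> \<open>\<open>\<Theta>\<close> is chosen so that B / K1 is the square of
      \<open>\<Theta> * N\<close>. The sum of the two squares is then enlarged by the nonnegative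
      cross term to allow taking roots.\<close>
    also have "\<dots> = (sqrt (K2 / K1) * norm (e 0))\<^sup>2 + (\<Theta> * N)\<^sup>2"
      using pos by (simp add: \<Theta>_def B_def power_mult_distrib add_divide_distrib)
    also have "\<dots> \<le> (sqrt (K2 / K1) * norm (e 0) + \<Theta> * N)\<^sup>2"
      unfolding power2_sum using \<Theta> N pos by simp
    finally show ?thesis
      by (rule power2_le_imp_le) (use \<Theta> N pos in simp)
  qed
  define q where "q = r * L * exp (\<omega> * r) * \<Theta>"
  define S where "S = sqrt (K2 / K1) * norm (e 0) + exp (\<omega> * r) * \<Theta> * q0"
  \<comment> \<open>The loop closes here: N itself contains E, with total coefficient q.\<close>
  have "E \<le> sqrt (K2 / K1) * norm (e 0) + \<Theta> * N" unfolding E_def by (rule bound[OF sm])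
  also have "\<dots> = S + exp (\<omega> * r) * \<Theta> * W * exp (\<omega> * T) + q * E"
    by (simp add: N_def S_def q_def algebra_simps)
  finally have "(1 - q) * E \<le> S + exp (\<omega> * r) * \<Theta> * W * exp (\<omega> * T)" by (simp add: algebra_simps)
  moreover have "(1 - q) * norm (e T) \<le> (1 - q) * (exp (- \<omega> * T) * E)"
    using gain by (intro mult_left_mono eE T) (auto simp: q_def)
  ultimately have "(1 - q) * norm (e T) \<le> exp (- \<omega> * T) * (S + exp (\<omega> * r) * \<Theta> * W * exp (\<omega> * T))"
    by (smt (verit) mult.left_commute mult_left_mono exp_ge_zero)
  also have "\<dots> = exp (- \<omega> * T) * S + exp (\<omega> * r) * \<Theta> * W"
    by (simp add: algebra_simps flip: exp_add)
  finally show ?thesis unfolding q_def S_def .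
qed

text \<open>The gain condition is strict and its left side is continuous in \<omega> from the right
  at 0, so it survives for small positive \<omega>.\<close>

lemma exponential_weight_exists:
  fixes r L \<gamma> \<mu> K1 :: real
  assumes "0 < \<mu>" "0 < K1" "r * L * sqrt (\<gamma> / (2 * \<mu> * K1)) < 1"
  obtains \<omega> where "0 < \<omega>" "\<omega> < \<mu>" "r * L * exp (\<omega> * r) * sqrt (\<gamma> / (2 * (\<mu> - \<omega>) * K1)) < 1"
proof -
  have "((\<lambda>\<omega>. r * L * exp (\<omega> * r) * sqrt (\<gamma> / (2 * (\<mu> - \<omega>) * K1)))
      \<longlongrightarrow> r * L * exp (0 * r) * sqrt (\<gamma> / (2 * (\<mu> - 0) * K1))) (at_right 0)"
    using assms by (intro tendsto_intros) auto
  then have "eventually (\<lambda>\<omega>. r * L * exp (\<omega> * r) * sqrt (\<gamma> / (2 * (\<mu> - \<omega>) * K1)) < 1) (at_right 0)"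
    by (rule order_tendstoD) (use assms in simp)
  moreover have "eventually (\<lambda>\<omega>. \<omega> \<in> {0<..<\<mu>}) (at_right 0)"
    using assms by (intro eventually_at_right_real)
  ultimately have "eventually (\<lambda>\<omega>. \<omega> \<in> {0<..<\<mu>} \<and>
      r * L * exp (\<omega> * r) * sqrt (\<gamma> / (2 * (\<mu> - \<omega>) * K1)) < 1) (at_right 0)"
    by eventually_elim simp
  then obtain \<omega> where "\<omega> \<in> {0<..<\<mu>} \<and>
      r * L * exp (\<omega> * r) * sqrt (\<gamma> / (2 * (\<mu> - \<omega>) * K1)) < 1"
    by (metis (no_types, lifting) eventually_happens' trivial_limit_at_right_real)
  then show ?thesis using that by auto
qed

section \<open>Sampled-data systems\<close>

lemma sampling_time_less_Suc: "0 < r \<Longrightarrow> sampling_time r d i < sampling_time r d (Suc i)"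
  by simp

lemma sampling_time_strict_mono: "0 < r \<Longrightarrow> strict_mono (sampling_time r d)"
  by (simp add: strict_mono_Suc_iff)

lemma sampling_time_nonneg: "0 < r \<Longrightarrow> 0 \<le> sampling_time r d i"
  by (induction i) simp_all

lemma sampling_time_diam:
  assumes "0 < r" "d \<in> Linf_loc {0..}"
  shows "sampling_time r d (Suc i) - sampling_time r d i \<le> r"
  using assms sampling_time_nonneg[of r d i] by (simp add: Linf_loc_def)

text \<open>Accumulation of sampling times is excluded. If all of them stayed below T, d would be
  bounded by some B along them, so every step would have length at least
  \<open>r * exp (- B)\<close>. The bound must hold at each individual point, as d is evaluated only
  at the sampling times.\<close>

lemma sampling_time_unbounded:
  assumes r: "0 < r" and d: "d \<in> Linf_loc {0..}"
  obtains N where "T < sampling_time r d N"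
proof (rule ccontr)
  assume "\<not> thesis"
  with that have le: "sampling_time r d i \<le> T" for i by (meson not_le)
  have T: "0 \<le> T" using le[of 0] by simp
  then have "bounded (d ` {0..T})" using d by (simp add: Linf_loc_def)
  then obtain B where B: "\<And>s. 0 \<le> s \<Longrightarrow> s \<le> T \<Longrightarrow> \<bar>d s\<bar> \<le> B"
    unfolding bounded_iff by (metis atLeastAtMost_iff image_eqI real_norm_def)
  have "real n * (r * exp (- B)) \<le> sampling_time r d n" for n
  proof (induction n)
    case (Suc n)
    have "d (sampling_time r d n) \<le> B"
      using B[of "sampling_time r d n"] le[of n] sampling_time_nonneg[OF r, of d n] by simp
    then have "r * exp (- B) \<le> r * exp (- d (sampling_time r d n))" using r by simp
    with Suc show ?case by (simp add: algebra_simps)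
  qed simp
  moreover obtain n where "T < real n * (r * exp (- B))"
    using reals_Archimedean3[of "r * exp (- B)"] r by auto
  ultimately show False using le[of n] by (smt (verit))
qed

text \<open>The plant does not depend on the observer, so its trajectory and all measurements are
  fixed first. The observer state is then assembled from one globally defined flow per sampling
  interval.\<close>

lemma hybrid_solution_exists:
  assumes r: "0 < r"
    and plant: "\<exists>x. x 0 = x0 \<and> (\<forall>t\<ge>0. (x has_vector_derivative f (x t)) (at t within {0..}))"
    and flow: "\<And>\<zeta>s y. \<exists>\<psi>. \<psi> 0 = \<zeta>s \<and> (\<forall>t. (\<psi> has_vector_derivative g (\<psi> t, \<zeta>s, y)) (at t))"
  shows "\<exists>x \<zeta>. hybrid_solution f h g G r x0 \<zeta>0 d v x \<zeta>"
proof -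
  obtain x where x: "x 0 = x0" "\<And>t. t \<ge> 0 \<Longrightarrow> (x has_vector_derivative f (x t)) (at t within {0..})"
    using plant by blast
  obtain \<psi> where \<psi>: "\<And>\<zeta>s y. \<psi> \<zeta>s y 0 = \<zeta>s"
      "\<And>\<zeta>s y t. (\<psi> \<zeta>s y has_vector_derivative g (\<psi> \<zeta>s y t, \<zeta>s, y)) (at t)"
    using flow by metis
  define \<tau> where "\<tau> = sampling_time r d"
  define y where "y i = h (x (\<tau> i)) + v (\<tau> i)" for i
  \<comment> \<open>The state at each node: flow from the previous node over one interval with the
    old measurement held, then jump with the new one.\<close>
  define st where "st = rec_nat \<zeta>0 (\<lambda>i s. G (\<psi> s (y i) (\<tau> (Suc i) - \<tau> i), y (Suc i)))"
  define piece where "piece i t = \<psi> (st i) (y i) (t - \<tau> i)" for i t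
  define \<zeta> where "\<zeta> t = piece (LEAST i. t < \<tau> (Suc i)) t" for t
  have sm: "strict_mono \<tau>" unfolding \<tau>_def by (rule sampling_time_strict_mono[OF r])
  have \<zeta>: "\<zeta> t = piece i t" if "\<tau> i \<le> t" "t < \<tau> (Suc i)" for i t
  proof -
    have "(LEAST i. t < \<tau> (Suc i)) = i"
    proof (rule Least_equality)
      fix j assume "t < \<tau> (Suc j)"
      with that(1) have "\<tau> i < \<tau> (Suc j)" by simp
      then show "i \<le> j" using sm by (simp add: strict_mono_less)
    qed (fact that)
    then show ?thesis by (simp add: \<zeta>_def)
  qed
  have piece: "(piece i has_vector_derivative g (piece i t, st i, y i)) (at t)" for i t
    using vector_diff_chain_at[of "\<lambda>t. t - \<tau> i" 1 t "\<psi> (st i) (y i)", OF _ \<psi>(2)]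
    by (force simp: piece_def[abs_def] o_def intro!: derivative_eq_intros)
  have less: "\<tau> i < \<tau> (Suc i)" for i using sm by (simp add: strict_mono_less)
  have \<zeta>_node: "\<zeta> (\<tau> i) = st i" for i
    using \<zeta>[of i "\<tau> i"] less[of i] by (simp add: piece_def \<psi>)
  have "\<zeta> 0 = \<zeta>0" using \<zeta>_node[of 0] by (simp add: \<tau>_def st_def)
  moreover have "(\<zeta> has_vector_derivative g (\<zeta> t, \<zeta> (\<tau> i), y i)) (at t within {\<tau> i..<\<tau> (Suc i)})"
    if t: "t \<in> {\<tau> i..<\<tau> (Suc i)}" for i t
  proof (rule has_vector_derivative_transform[OF t])
    show "(piece i has_vector_derivative g (\<zeta> t, \<zeta> (\<tau> i), y i)) (at t within {\<tau> i..<\<tau> (Suc i)})"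
      using has_vector_derivative_at_within[OF piece[of i t]] t \<zeta>_node[of i] \<zeta>[of i t] by simp
  qed (use \<zeta> in auto)
  moreover have "\<exists>l. (\<zeta> \<longlongrightarrow> l) (at_left (\<tau> (Suc i))) \<and> \<zeta> (\<tau> (Suc i)) = G (l, y (Suc i))" for i
  proof (intro exI conjI)
    \<comment> \<open>The flow piece extends beyond its interval, so its value at the right end is
      the left limit required by the jump.\<close>
    have "isCont (piece i) (\<tau> (Suc i))"
      using has_vector_derivative_continuous[OF piece] .
    then have "(piece i \<longlongrightarrow> piece i (\<tau> (Suc i))) (at_left (\<tau> (Suc i)))"
      by (simp add: isCont_def filterlim_at_split)
    moreover have "eventually (\<lambda>t. piece i t = \<zeta> t) (at_left (\<tau> (Suc i)))"
      using eventually_at_left_real[OF less[of i]] by eventually_elim (use \<zeta>[of i] in auto)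
    ultimately show "(\<zeta> \<longlongrightarrow> piece i (\<tau> (Suc i))) (at_left (\<tau> (Suc i)))"
      by (rule Lim_transform_eventually)
    show "\<zeta> (\<tau> (Suc i)) = G (piece i (\<tau> (Suc i)), y (Suc i))"
      unfolding \<zeta>_node by (simp add: st_def piece_def)
  qed
  ultimately have "hybrid_solution f h g G r x0 \<zeta>0 d v x \<zeta>"
    unfolding hybrid_solution_def Let_def \<tau>_def[symmetric] using x by (auto simp: y_def)
  then show ?thesis by blast
qed

section \<open>Continuity across sampling times\<close>

lemma continuous_on_consecutive_intervals:
  fixes \<tau> :: "nat \<Rightarrow> real" and f :: "real \<Rightarrow> 'a::topological_space"
  assumes "strict_mono \<tau>" "\<And>i. continuous_on {\<tau> i..\<tau> (Suc i)} f"
  shows "continuous_on {\<tau> 0..\<tau> N} f"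
proof (induction N)
  case (Suc N)
  have "\<tau> 0 \<le> \<tau> N" "\<tau> N \<le> \<tau> (Suc N)"
    using assms(1) by (simp_all add: strict_mono_less_eq)
  then have "{\<tau> 0..\<tau> (Suc N)} = {\<tau> 0..\<tau> N} \<union> {\<tau> N..\<tau> (Suc N)}" by auto
  then show ?case
    using continuous_on_closed_Un[OF closed_atLeastAtMost closed_atLeastAtMost Suc assms(2)] by simp
qed simp

lemma continuous_on_Icc_from_Ico:
  fixes f :: "real \<Rightarrow> 'a::topological_space"
  assumes "a < b" "continuous_on {a..<b} f" "(f \<longlongrightarrow> f b) (at_left b)"
  shows "continuous_on {a..b} f"
  unfolding continuous_on_def
proof
  fix t assume t: "t \<in> {a..b}"
  show "(f \<longlongrightarrow> f t) (at t within {a..b})"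
  proof (cases "t = b")
    case True
    then show ?thesis using assms by (simp add: at_within_Icc_at_left)
  next
    case False
    have "at t within {a..b} = at t within {a..<b}"
      by (rule at_within_nhd[of _ "{..<b}"]) (use t False in auto)
    then show ?thesis using assms(2) t False by (simp add: continuous_on_def)
  qed
qed

section \<open>The error dynamics\<close>

lemma outer_product_mult: "outer_product u w *v x = (w \<bullet> x) *\<^sub>R u"
  by (simp add: vec_eq_iff matrix_vector_mult_def outer_product_def inner_vec_def
      sum_distrib_left mult_ac)

locale lin_observer =
  fixes A P :: "real^'n^'n" and c k :: "real^'n" and \<mu> \<gamma> K1 K2 r :: real
  assumes sym: "transpose P = P"
    and pos: "0 < \<mu>" "0 < \<gamma>" "0 < K1" "0 < K2" "0 < r"
    and dissipation: "\<And>(x::real^'n) (v::real).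
           x \<bullet> ((P ** (A + outer_product k c)) *v x)
           + x \<bullet> (((transpose A + outer_product c k) ** P) *v x)
           + 2 * (x \<bullet> (P *v k)) * v
           \<le> - 2 * \<mu> * (x \<bullet> (P *v x)) + \<gamma> * \<bar>v\<bar>\<^sup>2"
    and P_bounds: "\<And>x. K1 * (norm x)\<^sup>2 \<le> x \<bullet> (P *v x)" "\<And>x. x \<bullet> (P *v x) \<le> K2 * (norm x)\<^sup>2"
    and gain: "r * norm (c v* A) * sqrt (\<gamma> / (2 * \<mu> * K1)) < 1"
begin

abbreviation solution where
  "solution \<equiv> hybrid_solution (\<lambda>x. A *v x) (\<lambda>x. c \<bullet> x) (lin_observer_flow A c k) lin_observer_jump r"

text \<open>The left side is the derivative of x'Px along x' = (A + kc')x + kw. Transposing A + kc'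
  and using the symmetry of P identifies it with the quadratic form in the hypothesis; the two terms
  containing w coincide and give 2x'Pkw.\<close>

lemma error_dissipation:
  "x \<bullet> (P *v (A *v x + (c \<bullet> x + w) *\<^sub>R k)) + (A *v x + (c \<bullet> x + w) *\<^sub>R k) \<bullet> (P *v x)
    \<le> - 2 * \<mu> * (x \<bullet> (P *v x)) + \<gamma> * w\<^sup>2"
proof -
  have adj: "u \<bullet> (M *v w) = (transpose M *v u) \<bullet> w" for u w and M :: "real^'n^'n"
    by (simp add: dot_lmul_matrix)
  have tr: "transpose A + outer_product c k = transpose (A + outer_product k c)"
    by (simp add: vec_eq_iff transpose_def outer_product_def)
  let ?M = "A + outer_product k c"
  have M: "A *v x + (c \<bullet> x + w) *\<^sub>R k = ?M *v x + w *\<^sub>R k"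
    by (simp add: matrix_vector_mult_add_rdistrib outer_product_mult scaleR_left_distrib)
  have "x \<bullet> ((transpose ?M ** P) *v x) = (?M *v x) \<bullet> (P *v x)"
    using adj[of x "transpose ?M" "P *v x"] by (simp add: matrix_vector_mul_assoc)
  moreover have "k \<bullet> (P *v x) = x \<bullet> (P *v k)"
    using adj[of k P x] sym by (simp add: inner_commute)
  moreover have "x \<bullet> (P *v (?M *v x)) = x \<bullet> ((P ** ?M) *v x)"
    by (simp add: matrix_vector_mul_assoc)
  ultimately show ?thesis
    using dissipation[of x w] unfolding tr M
    by (simp add: matrix_vector_right_distrib matrix_vector_mult_scaleR inner_add inner_add_left algebra_simps)
qed

section \<open>Error dynamics along a fixed solution\<close>

context
  fixes x0 \<zeta>0 d v x \<zeta> e \<eta>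
  assumes sol: "solution x0 \<zeta>0 d v x \<zeta>" and d: "d \<in> Linf_loc {0..}"
  defines "e \<equiv> (\<lambda>t. fst (\<zeta> t) - x t)" and "\<eta> \<equiv> (\<lambda>t. c \<bullet> x t - snd (\<zeta> t))"
begin

abbreviation (input) "\<tau> \<equiv> sampling_time r d"

lemma plant_derivative: "0 \<le> t \<Longrightarrow> (x has_vector_derivative A *v x t) (at t within {0..})"
  using sol by (simp add: hybrid_solution_def Let_def)

lemma observer_derivative:
  assumes "\<tau> i \<le> t" "t < \<tau> (Suc i)"
  shows "(\<zeta> has_vector_derivative
    (A *v fst (\<zeta> t) + (c \<bullet> fst (\<zeta> t) - snd (\<zeta> t)) *\<^sub>R k, c \<bullet> (A *v fst (\<zeta> t))))
    (at t within {\<tau> i..<\<tau> (Suc i)})"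
proof -
  have "(\<zeta> has_vector_derivative lin_observer_flow A c k (\<zeta> t, \<zeta> (\<tau> i), c \<bullet> x (\<tau> i) + v (\<tau> i)))
    (at t within {\<tau> i..<\<tau> (Suc i)})"
    using sol assms unfolding hybrid_solution_def Let_def by (meson atLeastLessThan_iff)
  then show ?thesis by (simp add: lin_observer_flow_def case_prod_unfold)
qed

text \<open>Writing c'z - w = c'e + \<eta> turns the injection term into feedback from e plus the
  input \<eta>. Since w integrates c'Az while c'x has derivative c'Ax, the derivative of \<eta>
  involves e alone.\<close>

lemma error_derivatives:
  assumes t: "\<tau> i \<le> t" "t < \<tau> (Suc i)"
  shows "(e has_vector_derivative A *v e t + (c \<bullet> e t + \<eta> t) *\<^sub>R k) (at t within {\<tau> i..<\<tau> (Suc i)})"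
    and "(\<eta> has_vector_derivative - (c \<bullet> (A *v e t))) (at t within {\<tau> i..<\<tau> (Suc i)})"
proof -
  note [derivative_intros] =
    bounded_linear.has_vector_derivative[OF bounded_linear_fst]
    bounded_linear.has_vector_derivative[OF bounded_linear_snd]
    bounded_linear.has_vector_derivative[OF bounded_linear_inner_right]
  have "0 \<le> \<tau> i" by (rule sampling_time_nonneg[OF pos(5)])
  then have x: "(x has_vector_derivative A *v x t) (at t within {\<tau> i..<\<tau> (Suc i)})"
    using plant_derivative[of t] t by (auto intro: has_vector_derivative_within_subset)
  note \<zeta> = observer_derivative[OF t]
  show "(e has_vector_derivative A *v e t + (c \<bullet> e t + \<eta> t) *\<^sub>R k) (at t within {\<tau> i..<\<tau> (Suc i)})"
    unfolding e_def \<eta>_def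
    by (rule has_vector_derivative_eq_rhs, (rule derivative_intros \<zeta> x)+)
      (simp add: matrix_vector_mult_diff_distrib inner_diff_right algebra_simps)
  show "(\<eta> has_vector_derivative - (c \<bullet> (A *v e t))) (at t within {\<tau> i..<\<tau> (Suc i)})"
    unfolding e_def \<eta>_def
    by (rule has_vector_derivative_eq_rhs, (rule derivative_intros \<zeta> x)+)
      (simp add: matrix_vector_mult_diff_distrib inner_diff_right)
qed

lemma error_interior_derivatives:
  assumes t: "\<tau> i < t" "t < \<tau> (Suc i)"
  shows "(e has_vector_derivative A *v e t + (c \<bullet> e t + \<eta> t) *\<^sub>R k) (at t)"
    and "(\<eta> has_real_derivative - (c \<bullet> (A *v e t))) (at t)"
proof -
  have "at t within {\<tau> i..<\<tau> (Suc i)} = at t"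
    by (rule at_within_interior) (use t in \<open>simp del: sampling_time.simps\<close>)
  then show "(e has_vector_derivative A *v e t + (c \<bullet> e t + \<eta> t) *\<^sub>R k) (at t)"
    and "(\<eta> has_real_derivative - (c \<bullet> (A *v e t))) (at t)"
    using error_derivatives[of i t] t unfolding has_real_derivative_iff_has_vector_derivative by simp_all
qed

lemma continuous_on_\<eta>: "continuous_on {\<tau> i..<\<tau> (Suc i)} \<eta>"
  using error_derivatives(2) has_vector_derivative_continuous
  by (fastforce simp: continuous_on_eq_continuous_within simp del: sampling_time.simps)

text \<open>The jump preserves z and resets w to the noisy output. The node at time 0 is excluded,
  because the initial value of w is arbitrary.\<close>

lemma error_jump: "((\<lambda>t. fst (\<zeta> t)) \<longlongrightarrow> fst (\<zeta> (\<tau> (Suc i)))) (at_left (\<tau> (Suc i)))"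
    "\<eta> (\<tau> (Suc i)) = - v (\<tau> (Suc i))"
proof -
  obtain l where l: "(\<zeta> \<longlongrightarrow> l) (at_left (\<tau> (Suc i)))"
      "\<zeta> (\<tau> (Suc i)) = lin_observer_jump (l, c \<bullet> x (\<tau> (Suc i)) + v (\<tau> (Suc i)))"
    using sol unfolding hybrid_solution_def Let_def by blast
  show "((\<lambda>t. fst (\<zeta> t)) \<longlongrightarrow> fst (\<zeta> (\<tau> (Suc i)))) (at_left (\<tau> (Suc i)))"
    using tendsto_fst[OF l(1)] l(2) by (simp add: lin_observer_jump_def case_prod_unfold)
  show "\<eta> (\<tau> (Suc i)) = - v (\<tau> (Suc i))"
    using l(2) by (simp add: \<eta>_def lin_observer_jump_def case_prod_unfold)
qed

lemma continuous_on_e: "continuous_on {0..T} e"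
proof -
  obtain N where N: "T < \<tau> N" by (rule sampling_time_unbounded[OF pos(5) d])
  have x: "continuous_on {0..} x"
    using plant_derivative has_vector_derivative_continuous
    by (fastforce simp: continuous_on_eq_continuous_within)
  have "continuous_on {\<tau> 0..\<tau> N} e"
  proof (rule continuous_on_consecutive_intervals[OF sampling_time_strict_mono[OF pos(5)]])
    fix i
    have less: "\<tau> i < \<tau> (Suc i)" by (rule sampling_time_less_Suc[OF pos(5)])
    have nonneg: "0 \<le> \<tau> i" by (rule sampling_time_nonneg[OF pos(5)])
    show "continuous_on {\<tau> i..\<tau> (Suc i)} e"
    proof (rule continuous_on_Icc_from_Ico[OF less])
      show "continuous_on {\<tau> i..<\<tau> (Suc i)} e"
        using error_derivatives(1) has_vector_derivative_continuous
        by (fastforce simp: continuous_on_eq_continuous_within simp del: sampling_time.simps)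
      have "continuous_on {\<tau> i..\<tau> (Suc i)} x"
        by (rule continuous_on_subset[OF x]) (use nonneg in auto)
      then have "(x \<longlongrightarrow> x (\<tau> (Suc i))) (at_left (\<tau> (Suc i)))"
        using less by (rule continuous_on_Icc_at_leftD)
      then show "(e \<longlongrightarrow> e (\<tau> (Suc i))) (at_left (\<tau> (Suc i)))"
        using error_jump(1)[of i] unfolding e_def by (intro tendsto_diff)
    qed
  qed
  then show ?thesis by (rule continuous_on_subset) (use N in auto)
qed

lemma Lyapunov_derivative:
  assumes "\<tau> i < t" "t < \<tau> (Suc i)"
  shows "\<exists>D. ((\<lambda>t. e t \<bullet> (P *v e t)) has_real_derivative D) (at t)
    \<and> D \<le> - 2 * \<mu> * (e t \<bullet> (P *v e t)) + \<gamma> * (\<eta> t)\<^sup>2"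
proof (intro exI conjI)
  note e = error_interior_derivatives(1)[OF assms]
  show "((\<lambda>t. e t \<bullet> (P *v e t)) has_real_derivative
      (e t \<bullet> (P *v (A *v e t + (c \<bullet> e t + \<eta> t) *\<^sub>R k)) + (A *v e t + (c \<bullet> e t + \<eta> t) *\<^sub>R k) \<bullet> (P *v e t))) (at t)"
    unfolding has_real_derivative_iff_has_vector_derivative
    by (rule bounded_bilinear.has_vector_derivative[OF bounded_bilinear_inner e
          bounded_linear.has_vector_derivative[OF matrix_vector_mul_bounded_linear e]])
qed (rule error_dissipation)

lemma \<eta>_derivative:
  assumes "\<tau> i < t" "t < \<tau> (Suc i)"
  shows "\<exists>D. (\<eta> has_real_derivative D) (at t) \<and> \<bar>D\<bar> \<le> norm (c v* A) * norm (e t)"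
proof (intro exI conjI)
  show "\<bar>- (c \<bullet> (A *v e t))\<bar> \<le> norm (c v* A) * norm (e t)"
    using Cauchy_Schwarz_ineq2[of "c v* A" "e t"] by (simp add: dot_lmul_matrix)
qed (rule error_interior_derivatives(2)[OF assms])

text \<open>C enters through two inequalities so that one constant serves as gain for the initial
  data and for the noise. W may be any bound of the noise on [0,T], in particular 0. The second
  estimate needs no decay; it serves to bound w.\<close>

lemma error_estimate:
  assumes \<omega>: "0 < \<omega>" "\<omega> < \<mu>" and T: "0 \<le> T"
    and W: "\<And>s. 0 \<le> s \<Longrightarrow> s \<le> T \<Longrightarrow> \<bar>v s\<bar> \<le> W"
    and small: "r * norm (c v* A) * exp (\<omega> * r) * sqrt (\<gamma> / (2 * (\<mu> - \<omega>) * K1)) < 1"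
    and C: "sqrt (K2 / K1) \<le> (1 - r * norm (c v* A) * exp (\<omega> * r) * sqrt (\<gamma> / (2 * (\<mu> - \<omega>) * K1))) * C"
      "exp (\<omega> * r) * sqrt (\<gamma> / (2 * (\<mu> - \<omega>) * K1))
        \<le> (1 - r * norm (c v* A) * exp (\<omega> * r) * sqrt (\<gamma> / (2 * (\<mu> - \<omega>) * K1))) * C"
  shows "norm (e T) \<le> C * (exp (- \<omega> * T) * (norm (e 0) + \<bar>\<eta> 0\<bar>) + W)"
    and "\<bar>\<eta> T\<bar> \<le> (1 + r * norm (c v* A) * C) * (norm (e 0) + \<bar>\<eta> 0\<bar> + W)"
proof -
  define q where "q = r * norm (c v* A) * exp (\<omega> * r) * sqrt (\<gamma> / (2 * (\<mu> - \<omega>) * K1))"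
  have W0: "0 \<le> W" using W[of 0] T by simp
  \<comment> \<open>At index 0 the free initial prediction error appears, at later indices the noise
    at the reset.\<close>
  have sample: "\<bar>\<eta> (\<tau> i)\<bar> \<le> exp (- \<omega> * \<tau> i) * \<bar>\<eta> 0\<bar> + W" if "\<tau> i \<le> T" for i
  proof (cases i)
    case 0
    then show ?thesis using W0 by simp
  next
    case (Suc j)
    then have "\<bar>\<eta> (\<tau> i)\<bar> = \<bar>v (\<tau> i)\<bar>" by (simp add: error_jump(2) del: sampling_time.simps)
    also have "\<dots> \<le> W" by (rule W[OF sampling_time_nonneg[OF pos(5)] that])
    finally show ?thesis by (simp add: add_increasing)
  qed
  \<comment> \<open>Stated for all s up to T, since bounding \<eta> at T requires e on the whole
    last sampling interval.\<close>
  have err: "norm (e s) \<le> C * (exp (- \<omega> * s) * (norm (e 0) + \<bar>\<eta> 0\<bar>) + W)"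
    if s: "0 \<le> s" "s \<le> T" for s
  proof -
    obtain N where N: "s < \<tau> N" by (rule sampling_time_unbounded[OF pos(5) d])
    have q1: "0 < 1 - q" using small by (simp add: q_def)
    have "(1 - q) * norm (e s) \<le> exp (- \<omega> * s) * (sqrt (K2 / K1) * norm (e 0)
        + exp (\<omega> * r) * sqrt (\<gamma> / (2 * (\<mu> - \<omega>) * K1)) * \<bar>\<eta> 0\<bar>)
        + exp (\<omega> * r) * sqrt (\<gamma> / (2 * (\<mu> - \<omega>) * K1)) * W"
      unfolding q_def
    proof (rule weighted_small_gain[where \<tau> = \<tau> and M = N and V = "\<lambda>t. e t \<bullet> (P *v e t)"])
      show "continuous_on {0..s} (\<lambda>t. e t \<bullet> (P *v e t))"
        by (intro continuous_intros continuous_on_e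
            bounded_linear.continuous_on[OF matrix_vector_mul_bounded_linear])
      show "\<tau> i < \<tau> (Suc i)" for i by (rule sampling_time_less_Suc[OF pos(5)])
      show "\<bar>\<eta> (\<tau> i)\<bar> \<le> exp (- \<omega> * \<tau> i) * \<bar>\<eta> 0\<bar> + W" if "\<tau> i \<le> s" for i
        using sample that s by simp
    qed (use s N \<omega> pos W0 P_bounds small sampling_time_diam[OF pos(5) d] continuous_on_e
        continuous_on_\<eta> Lyapunov_derivative \<eta>_derivative in \<open>simp_all del: sampling_time.simps(2)\<close>)
    also have "\<dots> \<le> exp (- \<omega> * s) * ((1 - q) * C * norm (e 0) + (1 - q) * C * \<bar>\<eta> 0\<bar>) + (1 - q) * C * W"
      using C W0 unfolding q_def by (intro add_mono mult_left_mono mult_right_mono) auto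
    also have "\<dots> = (1 - q) * (C * (exp (- \<omega> * s) * (norm (e 0) + \<bar>\<eta> 0\<bar>) + W))"
      by (simp add: algebra_simps)
    finally show ?thesis using q1 by simp
  qed
  show "norm (e T) \<le> C * (exp (- \<omega> * T) * (norm (e 0) + \<bar>\<eta> 0\<bar>) + W)"
    by (rule err) (use T in auto)
  have C0: "0 \<le> C"
  proof -
    have "0 \<le> (1 - q) * C" using C(1) pos unfolding q_def by (smt (verit) real_sqrt_ge_zero divide_nonneg_pos)
    then show ?thesis using small by (simp add: q_def zero_le_mult_iff)
  qed
  define S where "S = norm (e 0) + \<bar>\<eta> 0\<bar> + W"
  have S: "0 \<le> S" "\<bar>\<eta> 0\<bar> + W \<le> S" using W0 by (auto simp: S_def)
  obtain N where "T < \<tau> N" by (rule sampling_time_unbounded[OF pos(5) d])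
  then obtain i where i: "\<tau> i \<le> T" "T < \<tau> (Suc i)"
    using sampling_index[of \<tau> T N] T by (auto simp del: sampling_time.simps(2))
  \<comment> \<open>The growth of \<eta> since the last sample, with e bounded by C S after dropping
    the exponential decay.\<close>
  have "\<bar>\<eta> T\<bar> \<le> \<bar>\<eta> (\<tau> i)\<bar> + (T - \<tau> i) * (norm (c v* A) * (C * S))"
  proof (rule bound_after_sample[OF i(1)])
    show "continuous_on {\<tau> i..T} \<eta>"
      by (rule continuous_on_subset[OF continuous_on_\<eta>[of i]]) (use i in auto)
    fix u assume u: "\<tau> i < u" "u < T"
    show "\<exists>D. (\<eta> has_real_derivative D) (at u) \<and> \<bar>D\<bar> \<le> norm (c v* A) * norm (e u)"
      by (rule \<eta>_derivative[OF u(1)]) (use u i in simp)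
    have u0: "0 \<le> u" using sampling_time_nonneg[OF pos(5), of d i] u by simp
    have "norm (e u) \<le> C * (exp (- \<omega> * u) * (norm (e 0) + \<bar>\<eta> 0\<bar>) + W)"
      by (rule err) (use u u0 in auto)
    also have "\<dots> \<le> C * S"
      unfolding S_def using u0 \<omega> C0 by (intro mult_left_mono add_mono mult_left_le_one_le) auto
    finally show "norm (e u) \<le> C * S" .
  qed (use C0 S in auto)
  also have "\<dots> \<le> S + r * (norm (c v* A) * (C * S))"
  proof (rule add_mono)
    have "exp (- \<omega> * \<tau> i) * \<bar>\<eta> 0\<bar> \<le> \<bar>\<eta> 0\<bar>"
      using \<omega> sampling_time_nonneg[OF pos(5), of d i] by (intro mult_left_le_one_le) auto
    then show "\<bar>\<eta> (\<tau> i)\<bar> \<le> S" using sample[OF i(1)] S by linarith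
    show "(T - \<tau> i) * (norm (c v* A) * (C * S)) \<le> r * (norm (c v* A) * (C * S))"
      using i sampling_time_diam[OF pos(5) d, of i] C0 S by (intro mult_right_mono) auto
  qed
  finally show "\<bar>\<eta> T\<bar> \<le> (1 + r * norm (c v* A) * C) * (norm (e 0) + \<bar>\<eta> 0\<bar> + W)"
    by (simp add: S_def algebra_simps)
qed

end

end


section \<open>The observer property\<close>

lemma linear_in_class_K: "0 < (a::real) \<Longrightarrow> (\<lambda>s. a * s) \<in> class_K"
  by (auto simp: class_K_def strict_mono_on_def intro!: continuous_intros)

lemma linear_in_class_Kinf: "0 < (a::real) \<Longrightarrow> (\<lambda>s. a * s) \<in> class_Kinf"
  by (auto simp: class_Kinf_def linear_in_class_K
      intro: filterlim_tendsto_pos_mult_at_top[OF tendsto_const _ filterlim_ident])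

lemma linear_in_class_N: "0 \<le> (a::real) \<Longrightarrow> (\<lambda>s. a * s) \<in> class_N"
  by (auto simp: class_N_def mono_on_def mult_left_mono intro!: continuous_intros)

lemma exp_decay_in_class_KL:
  fixes a \<omega> :: real
  assumes "0 < a" "0 < \<omega>"
  shows "(\<lambda>s t. a * exp (- \<omega> * t) * s) \<in> class_KL"
proof -
  have "continuous_on ({0..} \<times> {0..}) (\<lambda>(s, t). a * exp (- \<omega> * t) * s)"
    unfolding case_prod_unfold by (intro continuous_intros)
  moreover have "antimono_on {0..} (\<lambda>t. a * exp (- \<omega> * t) * s)" if "0 \<le> s" for s
    using assms that by (intro monotone_onI mult_right_mono mult_left_mono) auto
  moreover have "((\<lambda>t. a * exp (- \<omega> * t) * s) \<longlongrightarrow> 0) at_top" for s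
  proof -
    have "filterlim (\<lambda>t. \<omega> * t) at_top at_top"
      using assms by (intro filterlim_tendsto_pos_mult_at_top[OF tendsto_const _ filterlim_ident])
    then have "((\<lambda>t. exp (- \<omega> * t)) \<longlongrightarrow> 0) at_top"
      by (intro filterlim_compose[OF exp_at_bot]) (simp add: filterlim_uminus_at_bot)
    then show ?thesis
      using tendsto_mult_left[of _ 0 at_top a] tendsto_mult_right[of _ 0 at_top s] by fastforce
  qed
  ultimately show ?thesis
    using assms linear_in_class_K by (simp add: class_KL_def)
qed

text \<open>Local boundedness makes the real \<open>SUP\<close> a genuine supremum. The factor a is
  carried along because the observer estimates have the gain inside the supremum.\<close>

lemma Linf_loc_le_SUP:
  assumes "v \<in> Linf_loc UNIV" "0 < (a::real)" "0 \<le> s" "s \<le> T"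
  shows "\<bar>v s\<bar> \<le> (SUP s\<in>{0..T}. a * \<bar>v s\<bar>) / a"
proof -
  have "bounded (v ` {0..T})" using assms by (simp add: Linf_loc_def)
  then obtain B where B: "\<forall>s\<in>{0..T}. \<bar>v s\<bar> \<le> B"
    unfolding bounded_iff by (metis image_eqI real_norm_def)
  have "bdd_above ((\<lambda>s. a * \<bar>v s\<bar>) ` {0..T})"
    by (rule bdd_aboveI2[of _ _ "a * B"]) (use B assms in auto)
  then have "a * \<bar>v s\<bar> \<le> (SUP s\<in>{0..T}. a * \<bar>v s\<bar>)"
    by (intro cSUP_upper) (use assms in auto)
  then show ?thesis using assms by (simp add: field_simps)
qed

section \<open>Smoothness of linear maps and existence of observer solutions\<close>

lemma C1_map_bounded_linear:
  assumes "bounded_linear f"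
  shows "C1_map f"
  unfolding C1_map_def
proof (intro exI conjI allI)
  show "(f has_derivative blinfun_apply (Blinfun f)) (at x)" for x
    by (simp add: bounded_linear_Blinfun_apply assms bounded_linear_imp_has_derivative)
qed (rule continuous_on_const)

lemma C2_map_bounded_linear:
  assumes "bounded_linear f"
  shows "C2_map f"
  unfolding C2_map_def
proof (intro exI conjI allI)
  show "(f has_derivative blinfun_apply (Blinfun f)) (at x)" for x
    by (simp add: bounded_linear_Blinfun_apply assms bounded_linear_imp_has_derivative)
  show "C1_map (\<lambda>_. Blinfun f)"
    unfolding C1_map_def by (rule exI[of _ "\<lambda>_. 0"]) (simp add: zero_blinfun.rep_eq)
qed

lemma bounded_linear_lin_observer_flow: "bounded_linear (lin_observer_flow A c k)"
  unfolding linear_conv_bounded_linear[symmetric]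
  by (rule linearI)
    (auto simp: lin_observer_flow_def matrix_vector_right_distrib matrix_vector_mult_scaleR
      inner_add_right algebra_simps)

lemma (in lin_observer) solution_exists: "\<exists>x \<zeta>. solution x0 \<zeta>0 d v x \<zeta>"
proof (rule hybrid_solution_exists[OF pos(5)])
  obtain x where "x 0 = x0" "\<And>t. (x has_vector_derivative A *v x t) (at t)"
    using linear_ode_solution[OF matrix_vector_mul_bounded_linear[of A], where ?x0.0 = x0] by blast
  then show "\<exists>x. x 0 = x0 \<and> (\<forall>t\<ge>0. (x has_vector_derivative A *v x t) (at t within {0..}))"
    using has_vector_derivative_at_within by blast
next
  fix \<zeta>s :: "(real^'n) \<times> real" and y :: real
  \<comment> \<open>With zeros in the held arguments the flow is a linear map of \<zeta> alone, so
    the exponential series applies; the next step identifies it with the flow for the actual held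
    values.\<close>
  have "bounded_linear (\<lambda>\<zeta>::(real^'n) \<times> real. lin_observer_flow A c k (\<zeta>, 0, 0))"
    by (intro bounded_linear_compose[OF bounded_linear_lin_observer_flow]
        bounded_linear_Pair bounded_linear_ident bounded_linear_zero)
  moreover have "lin_observer_flow A c k (\<zeta>, \<zeta>s, y) = lin_observer_flow A c k (\<zeta>, 0, 0)" for \<zeta>
    by (simp add: lin_observer_flow_def case_prod_unfold)
  ultimately show "\<exists>\<psi>. \<psi> 0 = \<zeta>s \<and>
      (\<forall>t. (\<psi> has_vector_derivative lin_observer_flow A c k (\<psi> t, \<zeta>s, y)) (at t))"
    using linear_ode_solution[where ?x0.0 = \<zeta>s] by (metis (no_types, lifting))
qed

text \<open>All estimates are linear in the data, so linear gains suffice throughout. The state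
  \<zeta> follows the plant, which may be unstable, and its bound therefore carries the growth
  factor \<open>exp (L * t)\<close>.\<close>

lemma (in lin_observer) robust_observer:
  "robust_sampled_data_observer (\<lambda>x. A *v x) (\<lambda>x. c \<bullet> x)
     (lin_observer_flow A c k) lin_observer_jump fst r"
proof -
  obtain \<omega> where \<omega>: "0 < \<omega>" "\<omega> < \<mu>"
      "r * norm (c v* A) * exp (\<omega> * r) * sqrt (\<gamma> / (2 * (\<mu> - \<omega>) * K1)) < 1"
    using exponential_weight_exists[OF pos(1,3) gain] .
  define \<Theta> where "\<Theta> = sqrt (\<gamma> / (2 * (\<mu> - \<omega>) * K1))"
  define q where "q = r * norm (c v* A) * exp (\<omega> * r) * \<Theta>"
  \<comment> \<open>Adding the initial-data and noise coefficients of the small-gain estimate before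
    dividing by 1 - q makes C dominate both.\<close>
  define C where "C = (sqrt (K2 / K1) + exp (\<omega> * r) * \<Theta>) / (1 - q)"
  have q: "q < 1" using \<omega> by (simp add: q_def \<Theta>_def)
  have \<Theta>: "0 < \<Theta>" using \<omega> pos by (simp add: \<Theta>_def)
  have C: "0 < C" unfolding C_def using q \<Theta> pos by (intro divide_pos_pos add_pos_pos) auto
  have qC: "sqrt (K2 / K1) \<le> (1 - q) * C" "exp (\<omega> * r) * \<Theta> \<le> (1 - q) * C"
    using q \<Theta> pos by (auto simp: C_def)
  define C' where "C' = 1 + r * norm (c v* A) * C"
  have C': "0 < C'" using C pos by (simp add: C'_def add_pos_nonneg)
  note est = error_estimate[OF _ _ \<omega>(1,2) _ _ \<omega>(3) qC[unfolded q_def \<Theta>_def], folded C'_def]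
  \<comment> \<open>\<open>\<kappa>\<close> converts the initial values of e and \<eta> into the
    norms of x0 and \<zeta>0: e contributes 1 for each norm, and \<eta> contributes |c| for x0 and 1
    for \<zeta>0.\<close>
  define \<kappa> where "\<kappa> = 2 + norm c"
  have \<kappa>: "0 < \<kappa>" by (simp add: \<kappa>_def add_pos_nonneg)
  define L where "L = onorm ((*v) A)"
  have L: "0 \<le> L" unfolding L_def by (simp add: onorm_pos_le)
  have bounds: "norm (fst (\<zeta> t) - x t)
        \<le> C * \<kappa> * exp (- \<omega> * t) * (norm x0 + norm \<zeta>0) + (SUP s\<in>{0..t}. C * \<bar>v s\<bar>)
      \<and> norm (\<zeta> t) \<le> exp (L * t) * ((1 + norm c + (C + C') * \<kappa>) * (norm x0 + norm \<zeta>0)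
          + (SUP s\<in>{0..t}. (C + C') * \<bar>v s\<bar>))"
    if d: "d \<in> Linf_loc {0..}" and v: "v \<in> Linf_loc UNIV" and sol: "solution x0 \<zeta>0 d v x \<zeta>"
      and t: "0 \<le> t"
    for x0 \<zeta>0 d v x \<zeta> t
  proof
    define R where "R = norm (fst (\<zeta> 0) - x 0) + \<bar>c \<bullet> x 0 - snd (\<zeta> 0)\<bar>"
    define S where "S = norm x0 + norm \<zeta>0"
    have init: "x 0 = x0" "\<zeta> 0 = \<zeta>0" using sol by (auto simp: hybrid_solution_def Let_def)
    have R: "R \<le> \<kappa> * S"
    proof -
      have "norm (fst \<zeta>0 - x0) \<le> norm \<zeta>0 + norm x0"
        using norm_triangle_ineq4[of "fst \<zeta>0" x0] norm_fst_le[of "fst \<zeta>0" "snd \<zeta>0"] by simp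
      moreover have "\<bar>c \<bullet> x0 - snd \<zeta>0\<bar> \<le> norm c * norm x0 + norm \<zeta>0"
        using Cauchy_Schwarz_ineq2[of c x0] norm_snd_le[of "snd \<zeta>0" "fst \<zeta>0"] by simp
      moreover have "0 \<le> norm c * norm \<zeta>0" by simp
      moreover have "\<kappa> * S = 2 * norm x0 + 2 * norm \<zeta>0 + norm c * norm x0 + norm c * norm \<zeta>0"
        by (simp add: \<kappa>_def S_def algebra_simps)
      ultimately show ?thesis
        using norm_ge_zero[of x0] unfolding R_def init by linarith
    qed
    have "norm (fst (\<zeta> t) - x t)
        \<le> C * (exp (- \<omega> * t) * R + (SUP s\<in>{0..t}. C * \<bar>v s\<bar>) / C)"
      unfolding R_def by (rule est(1)[OF sol d t]) (rule Linf_loc_le_SUP[OF v C])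
    also have "\<dots> \<le> C * (exp (- \<omega> * t) * (\<kappa> * S) + (SUP s\<in>{0..t}. C * \<bar>v s\<bar>) / C)"
      using C R by (intro mult_left_mono add_mono) auto
    also have "\<dots> = C * \<kappa> * exp (- \<omega> * t) * S + (SUP s\<in>{0..t}. C * \<bar>v s\<bar>)"
      using C by (simp add: algebra_simps)
    finally show "norm (fst (\<zeta> t) - x t)
        \<le> C * \<kappa> * exp (- \<omega> * t) * (norm x0 + norm \<zeta>0) + (SUP s\<in>{0..t}. C * \<bar>v s\<bar>)"
      by (simp add: S_def)
    \<comment> \<open>Normalised so that the final coefficient C + C' ends up inside the
      supremum.\<close>
    define W where "W = (SUP s\<in>{0..t}. (C + C') * \<bar>v s\<bar>) / (C + C')"
    have v_le: "\<bar>v s\<bar> \<le> W" if "0 \<le> s" "s \<le> t" for s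
      unfolding W_def using C C' that by (intro Linf_loc_le_SUP[OF v]) auto
    have W0: "0 \<le> W" using v_le[of 0] t by simp
    have R0: "0 \<le> R" by (simp add: R_def)
    have x: "norm (x t) \<le> exp (L * t) * norm x0"
      unfolding L_def init(1)[symmetric] using sol t
      by (intro exponential_growth_bound) (auto simp: hybrid_solution_def Let_def)
    have e: "norm (fst (\<zeta> t) - x t) \<le> C * (R + W)"
    proof -
      have "norm (fst (\<zeta> t) - x t) \<le> C * (exp (- \<omega> * t) * R + W)"
        unfolding R_def by (rule est(1)[OF sol d t v_le])
      also have "\<dots> \<le> C * (R + W)"
        using C R0 \<omega> t by (intro mult_left_mono add_mono mult_left_le_one_le) auto
      finally show ?thesis .
    qed
    have \<eta>: "\<bar>c \<bullet> x t - snd (\<zeta> t)\<bar> \<le> C' * (R + W)"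
      unfolding R_def by (rule est(2)[OF sol d t v_le])
    have "norm (\<zeta> t) \<le> norm (fst (\<zeta> t)) + norm (snd (\<zeta> t))"
      using norm_Pair_le[of "fst (\<zeta> t)" "snd (\<zeta> t)"] by simp
    \<comment> \<open>The state is recovered from z = e + x and w = c'x - \<eta>.\<close>
    also have "\<dots> \<le> (C * (R + W) + norm (x t)) + (norm c * norm (x t) + C' * (R + W))"
    proof (rule add_mono)
      show "norm (fst (\<zeta> t)) \<le> C * (R + W) + norm (x t)"
        using e norm_triangle_sub[of "fst (\<zeta> t)" "x t"] by linarith
      show "norm (snd (\<zeta> t)) \<le> norm c * norm (x t) + C' * (R + W)"
        using \<eta> Cauchy_Schwarz_ineq2[of c "x t"] by simp
    qed
    also have "\<dots> = (1 + norm c) * norm (x t) + (C + C') * (R + W)"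
      by (simp add: algebra_simps)
    \<comment> \<open>Only the x part needs the exponential; the bounded part is enlarged by a
      factor at least 1 so that \<open>exp (L * t)\<close> can be taken out of the whole
      sum.\<close>
    also have "\<dots> \<le> (1 + norm c) * (exp (L * t) * S) + exp (L * t) * ((C + C') * (\<kappa> * S + W))"
    proof (rule add_mono)
      have "exp (L * t) * norm x0 \<le> exp (L * t) * S" by (simp add: S_def)
      with x have "norm (x t) \<le> exp (L * t) * S" by (rule order_trans)
      then show "(1 + norm c) * norm (x t) \<le> (1 + norm c) * (exp (L * t) * S)"
        by (intro mult_left_mono) auto
      have "(C + C') * (R + W) \<le> (C + C') * (\<kappa> * S + W)"
        using C C' R by (intro mult_left_mono add_mono) auto
      also have "\<dots> \<le> exp (L * t) * ((C + C') * (\<kappa> * S + W))"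
      proof -
        have "0 \<le> \<kappa> * S + W" using R R0 W0 by linarith
        moreover have "1 \<le> exp (L * t)" using L t by simp
        ultimately show ?thesis
          using mult_right_mono[of 1 "exp (L * t)" "(C + C') * (\<kappa> * S + W)"] C C' by simp
      qed
      finally show "(C + C') * (R + W) \<le> exp (L * t) * ((C + C') * (\<kappa> * S + W))" .
    qed
    also have "\<dots> = exp (L * t) * ((1 + norm c + (C + C') * \<kappa>) * S + (C + C') * W)"
      by (simp add: algebra_simps)
    also have "(C + C') * W = (SUP s\<in>{0..t}. (C + C') * \<bar>v s\<bar>)"
      using C C' by (simp add: W_def)
    finally show "norm (\<zeta> t) \<le> exp (L * t) * ((1 + norm c + (C + C') * \<kappa>) * (norm x0 + norm \<zeta>0)
          + (SUP s\<in>{0..t}. (C + C') * \<bar>v s\<bar>))"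
      by (simp add: S_def)
  qed
  have "admissible_system (\<lambda>x. A *v x) (\<lambda>x. c \<bullet> x)"
    by (simp add: admissible_system_def C1_map_bounded_linear C2_map_bounded_linear
        bounded_linear_inner_right)
  moreover have "admissible_sampled_data_system (lin_observer_flow A c k) lin_observer_jump
      (fst :: (real^'n) \<times> real \<Rightarrow> real^'n)"
  proof -
    have "continuous_on UNIV (lin_observer_jump :: ((real^'n) \<times> real) \<times> real \<Rightarrow> (real^'n) \<times> real)"
      unfolding lin_observer_jump_def case_prod_unfold by (intro continuous_intros)
    then show ?thesis
      by (simp add: admissible_sampled_data_system_def C1_map_bounded_linear
          bounded_linear_lin_observer_flow bounded_linear_fst)
        (simp add: lin_observer_flow_def lin_observer_jump_def zero_prod_def)
  qed
  moreover have "\<exists>\<sigma>\<in>class_KL. \<exists>\<gamma>\<in>class_N. \<exists>p\<in>class_N. \<exists>m\<in>class_Kplus. \<exists>a\<in>class_Kinf.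
        \<forall>x0 \<zeta>0. \<forall>d\<in>Linf_loc {0..}. \<forall>v\<in>Linf_loc UNIV.
          the_solution_satisfies (\<lambda>x. A *v x) (\<lambda>x. c \<bullet> x) (lin_observer_flow A c k) lin_observer_jump r x0 \<zeta>0 d v (\<lambda>x \<zeta> t.
            norm (fst (\<zeta> t) - x t)
              \<le> \<sigma> (norm x0 + norm \<zeta>0) t + (SUP s\<in>{0..t}. \<gamma> \<bar>v s\<bar>)
          \<and> norm (\<zeta> t) \<le> m t * (a (norm x0 + norm \<zeta>0) + (SUP s\<in>{0..t}. p \<bar>v s\<bar>)))"
  proof (rule bexI, rule bexI[of _ "\<lambda>s. C * s"], rule bexI[of _ "\<lambda>s. (C + C') * s"],
      intro bexI ballI allI)
    show "(\<lambda>s t. C * \<kappa> * exp (- \<omega> * t) * s) \<in> class_KL"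
      using C \<kappa> \<omega> by (intro exp_decay_in_class_KL) auto
    show "(\<lambda>s. C * s) \<in> class_N" "(\<lambda>s. (C + C') * s) \<in> class_N"
      using C C' by (auto intro!: linear_in_class_N)
    show "(\<lambda>t. exp (L * t)) \<in> class_Kplus"
      by (auto simp: class_Kplus_def intro!: continuous_intros)
    show "(\<lambda>s. (1 + norm c + (C + C') * \<kappa>) * s) \<in> class_Kinf"
      using C C' \<kappa> by (intro linear_in_class_Kinf add_pos_pos add_pos_nonneg mult_pos_pos) auto
  qed (use bounds solution_exists in \<open>simp add: the_solution_satisfies_def\<close>)
  moreover have "\<exists>\<zeta>0. \<forall>d\<in>Linf_loc {0..}. the_solution_satisfies (\<lambda>x. A *v x) (\<lambda>x. c \<bullet> x)
      (lin_observer_flow A c k) lin_observer_jump r x0 \<zeta>0 d (\<lambda>_. 0) (\<lambda>x \<zeta> t. x t = fst (\<zeta> t))" for x0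
  proof (intro exI ballI)
    fix d :: "real \<Rightarrow> real" assume d: "d \<in> Linf_loc {0..}"
    have "x t = fst (\<zeta> t)" if sol: "solution x0 (x0, c \<bullet> x0) d (\<lambda>_. 0) x \<zeta>" and t: "0 \<le> t" for x \<zeta> t
    proof -
      have "x 0 = x0" "\<zeta> 0 = (x0, c \<bullet> x0)" using sol by (auto simp: hybrid_solution_def Let_def)
      \<comment> \<open>The instantiation by 0 is the noise bound; the initial values of e and
        \<eta> vanish too, so the estimate forces e to be 0 at t.\<close>
      then show ?thesis using est(1)[OF sol d t, of 0] by simp
    qed
    then show "the_solution_satisfies (\<lambda>x. A *v x) (\<lambda>x. c \<bullet> x)
      (lin_observer_flow A c k) lin_observer_jump r x0 (x0, c \<bullet> x0) d (\<lambda>_. 0) (\<lambda>x \<zeta> t. x t = fst (\<zeta> t))"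
      using solution_exists by (simp add: the_solution_satisfies_def)
  qed
  ultimately show ?thesis
    using pos(5) unfolding robust_sampled_data_observer_def by blast
qed

theorem mainTheorem3:
  fixes A P :: "real^'n^'n" and c k :: "real^'n" and \<mu> \<gamma> K1 K2 r :: real
  assumes "hurwitz (A + outer_product k c)"
    and "transpose P = P" and "positive_definite P"
    and "negative_definite
           (P ** (A + outer_product k c) + (transpose A + outer_product c k) ** P)"
    and "0 < \<mu>" and "0 < \<gamma>"
    and "\<And>(x::real^'n) (v::real).
           x \<bullet> ((P ** (A + outer_product k c)) *v x)
           + x \<bullet> (((transpose A + outer_product c k) ** P) *v x)
           + 2 * (x \<bullet> (P *v k)) * v
           \<le> - 2 * \<mu> * (x \<bullet> (P *v x)) + \<gamma> * \<bar>v\<bar>\<^sup>2"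
    and "0 < K1" and "0 < K2"
    and "\<And>x::real^'n. K1 * (norm x)\<^sup>2 \<le> x \<bullet> (P *v x) \<and> x \<bullet> (P *v x) \<le> K2 * (norm x)\<^sup>2"
    and "0 < r"
    and "r * norm (c v* A) * sqrt (\<gamma> / (2 * \<mu> * K1)) < 1"
  shows "robust_sampled_data_observer (\<lambda>x. A *v x) (\<lambda>x. c \<bullet> x)
           (lin_observer_flow A c k) lin_observer_jump fst r"
proof -
  interpret lin_observer A P c k \<mu> \<gamma> K1 K2 r
    by unfold_locales (use assms in auto)
  show ?thesis by (rule robust_observer)
qed

end
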